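(* Let $\alpha\in[0,1]$. For each $L$, let $\bar S^{(0)}_m(L)$ be the average Rényi-$0$ entropy at bond $m$ ($0\le m\le L$) of states distributed according to the stationary distribution of the unitary circuit game with matchgates and gate disentangler on $L$ qubits at the critical point $p=\tfrac12$. Then $$\frac1L\,\bar S^{(0)}_{\lfloor\alpha L\rfloor}(L)\;\longrightarrow\;\alpha(1-\alpha)\qquad (L\to\infty).$$
   Context: Matchgate: a two-qubit unitary on nearest-neighbor qubits, of the form $G(A,B)$ acting as $A$ on $\mathrm{span}(|00\rangle,|11\rangle)$ and as $B$ on $\mathrm{span}(|01\rangle,|10\rangle)$, with $A,B$ unitary $2\times 2$ and $\det A=\det B$. $U_{j,j+1}$ denotes a gate acting on qubits $j,j+1$ ("bond $j$") of a line of $L$ qubits. Products act from right to left. Right standard form (RSF): a circuit is in the RSF (has the RSF layout) labeled by pairs of integers $((k_i,l_i))_{i=1}^{n_d}$, where $0\le n_d\le L/2$, $k_1\ge1$, $k_i\le k_{i+1}-2$, $1\le l_i\le L-k_i$, if it is the product $D^{(1)}\cdots D^{(n_d)}$ with $D^{(i)}=U^{(i,l_i)}_{k_i+l_i-1,k_i+l_i}\cdots U^{(i,1)}_{k_i,k_i+1}$. Circuits differing only by exchanging gates on disjoint qubits are identified. An RSF circuit $C$ represents the state $C|0\rangle^{\otimes L}$. Absorption algorithm: given an RSF matchgate circuit and a matchgate $A$ applied after it on bond $q$, it produces an RSF circuit representing the same state. "Locally" means up to exchanging gates on disjoint qubits, and "$\cdots|000\rangle$" means that no other gate acts earlier on the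 three involved qubits. At the start and after each step, if $A$ is adjacent (up to exchanging gates on disjoint qubits) to another gate on the same bond, the two are multiplied into one gate and the algorithm terminates. Step 1: if $A$ is locally in a sequence $A_{i-1,i}U_{i,i+1}U'_{i-1,i}$, replace it by an equal product $V_{i,i+1}V'_{i-1,i}A'_{i,i+1}$ of matchgates, set $A\leftarrow A'$, repeat Step 1; otherwise go to Step 2. Step 2: if $A$ is locally in a sequence $A_{i-1,i}U_{i,i+1}|000\rangle$, replace it by an equal $V_{i,i+1}A'_{i-1,i}|000\rangle$, set $A\leftarrow A'$; go to Step 3. Step 3: if $A$ is locally in a sequence $U_{i-1,i}A_{i,i+1}|000\rangle$, replace it by an equal $A'_{i,i+1}V_{i-1,i}|000\rangle$, set $A\leftarrow A'$; go to Step 4. Step 4: if $A$ is locally in a sequence $U_{i-1,i}U'_{i,i+1}A_{i-1,i}$, replace it by an equal product $A'_{i,i+1}V_{i-1,i}V'_{i,i+1}$, set $A\leftarrow A'$, repeat Step 4; otherwise terminate. (All these replacements by matchgates are always possible.) The resulting layout depends only on the initial layout and on $q$. Unitary circuit game with gate disentangler, with disentangling probability $p$: the state is kept as an RSF matchgate circuit. In each step a bond $b\in\{1,\dots,L-1\}$ is chosen uniformly at random. With probability $1-p$ (entangler) a random matchgate (Haar distributed) is applied on bond $b$ and absorbed by the absorption algorithm. With probability $p$ (disentangler) the following is done: if the state represented by the current RSF circuit $C$ can be rewritten, by running the absorption algorithm in reverse, as $A_{b,b+1}C'|0\rangle^{\otimes L}$ with $C'$ an RSF circuit having one gate fewer than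 $C$ (i.e. the layout of $C'$ is such that absorbing a gate on bond $b$ into it yields the layout of $C$), then $A^\dagger$ is applied on bond $b$, giving $C'$; otherwise nothing is done. Thus the game induces a Markov chain on the finite set of RSF layouts on $L$ qubits; the stationary distribution is the distribution reached after evolving for a sufficiently long time. Rényi-$0$ entropy: $S^{(0)}_m(|\psi\rangle)$ is the base-2 logarithm of the Schmidt rank of $|\psi\rangle$ across the bipartition $1\ldots m\,|\,m+1\ldots L$, with $S^{(0)}_0=S^{(0)}_L=0$. Standing (genericity) convention: each gate in an RSF circuit increases it maximally, i.e. starting from $S^{(0)}\equiv0$, applying a gate of the circuit on bond $m$ replaces $S^{(0)}_m$ by $1+\min\{S^{(0)}_{m-1},S^{(0)}_{m+1}\}$ and leaves the other values unchanged; so the entropy profile is determined by the RSF layout. $\bar S^{(0)}_m(L)$ is the expectation of $S^{(0)}_m$ over the stationary distribution. *)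

theory Defs
  imports
    "HOL-Probability.Probability_Mass_Function"
    "Jordan_Normal_Form.DL_Rank"
    "Jordan_Normal_Form.Schur_Decomposition"
begin

hide_const (open) Finite_Cartesian_Product.mat Finite_Cartesian_Product.vec Determinants.det
no_notation vec_nth (infixl \<open>$\<close> 90)

section \<open>Matchgate circuits and Renyi-0 entropy\<close>

text \<open>Qubits are numbered from 1 to L. A state is a vector of length 2 ^ L whose index has qubit 1
  as its most significant binary digit.\<close>

definition unitary_mat :: "nat \<Rightarrow> complex mat \<Rightarrow> bool" where
  "unitary_mat n A \<longleftrightarrow>
     A \<in> carrier_mat n n \<and> A * mat_adjoint A = 1\<^sub>m n \<and> mat_adjoint A * A = 1\<^sub>m n"

text \<open>The matrix of G(A,B) in the basis 00, 01, 10, 11.\<close>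

definition matchgate_mat :: "complex mat \<Rightarrow> complex mat \<Rightarrow> complex mat" where
  "matchgate_mat A B = mat_of_rows_list 4
     [[A $$ (0,0), 0,          0,          A $$ (0,1)],
      [0,          B $$ (0,0), B $$ (0,1), 0         ],
      [0,          B $$ (1,0), B $$ (1,1), 0         ],
      [A $$ (1,0), 0,          0,          A $$ (1,1)]]"

definition is_matchgate :: "complex mat \<Rightarrow> bool" where
  "is_matchgate G \<longleftrightarrow>
     (\<exists>A B. unitary_mat 2 A \<and> unitary_mat 2 B \<and> det A = det B \<and> G = matchgate_mat A B)"

text \<open>The operator on L qubits acting as G on qubits j, j + 1 and as the identity on all others
  (for 1 \<le> j and j + 1 \<le> L).\<close>

definition gate_op :: "nat \<Rightarrow> nat \<Rightarrow> complex mat \<Rightarrow> complex mat" where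
  "gate_op L j G = mat (2 ^ L) (2 ^ L) (\<lambda>(x, y).
     let r = 2 ^ (L - (j + 1)) in
     if x div (4 * r) = y div (4 * r) \<and> x mod r = y mod r
     then G $$ ((x div r) mod 4, (y div r) mod 4) else 0)"

text \<open>In all words and circuits below the head of the list is the leftmost factor of the product,
  i.e. the gate that acts last.\<close>

type_synonym circuit = "(nat \<times> complex mat) list"

definition circuit_state :: "nat \<Rightarrow> circuit \<Rightarrow> complex vec" where
  "circuit_state L C = foldr (\<lambda>(j, G) \<psi>. gate_op L j G *\<^sub>v \<psi>) C (unit_vec (2 ^ L) 0)"

definition schmidt_rank :: "nat \<Rightarrow> nat \<Rightarrow> complex vec \<Rightarrow> nat" where
  "schmidt_rank L m \<psi> = vec_space.rank (2 ^ m)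
     (mat (2 ^ m) (2 ^ (L - m)) (\<lambda>(a, b). \<psi> $ (a * 2 ^ (L - m) + b)))"

definition renyi0 :: "nat \<Rightarrow> nat \<Rightarrow> complex vec \<Rightarrow> real" where
  "renyi0 L m \<psi> = log 2 (real (schmidt_rank L m \<psi>))"

text \<open>The genericity convention: every gate of the circuit increases the entropy maximally.\<close>

definition generic :: "nat \<Rightarrow> circuit \<Rightarrow> bool" where
  "generic L C \<longleftrightarrow> (\<forall>C2 j G C1. C = C2 @ (j, G) # C1 \<longrightarrow>
     (\<forall>m\<le>L. renyi0 L m (circuit_state L ((j, G) # C1)) =
       (if m = j
        then 1 + min (renyi0 L (j - 1) (circuit_state L C1)) (renyi0 L (j + 1) (circuit_state L C1))
        else renyi0 L m (circuit_state L C1))))"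

section \<open>Right standard form\<close>

type_synonym layout = "(nat \<times> nat) list"

definition rsf_layouts :: "nat \<Rightarrow> layout set" where
  "rsf_layouts L = {d. 2 * length d \<le> L
     \<and> (\<forall>(k, l)\<in>set d. 1 \<le> k \<and> 1 \<le> l \<and> k + l \<le> L)
     \<and> (\<forall>i. Suc i < length d \<longrightarrow> fst (d ! i) + 2 \<le> fst (d ! Suc i))}"

definition rsf_word :: "layout \<Rightarrow> nat list" where
  "rsf_word d = concat (map (\<lambda>(k, l). rev [k..<k + l]) d)"

definition rsf_circuit :: "layout \<Rightarrow> circuit \<Rightarrow> bool" where
  "rsf_circuit d C \<longleftrightarrow> map fst C = rsf_word d \<and> (\<forall>(j, G)\<in>set C. is_matchgate G)"

section \<open>The absorption algorithm on layouts\<close>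

text \<open>Only the bonds of the gates matter for the layout. The flag marks the gate A that is
  being absorbed.\<close>

type_synonym marked_word = "(nat \<times> bool) list"

inductive exchange :: "marked_word \<Rightarrow> marked_word \<Rightarrow> bool" where
  "i + 2 \<le> j \<or> j + 2 \<le> i \<Longrightarrow> exchange (u @ [(i, s), (j, t)] @ v) (u @ [(j, t), (i, s)] @ v)"

abbreviation exchange_equiv :: "marked_word \<Rightarrow> marked_word \<Rightarrow> bool" (infix \<open>\<simeq>\<close> 50) where
  "w \<simeq> w' \<equiv> exchange\<^sup>*\<^sup>* w w'"

text \<open>Bond i occupies qubits i, i + 1; the gates in v avoid qubits i - 1, i, i + 1, so these are
  still in the state 000 after v.\<close>

definition fresh_below :: "nat \<Rightarrow> marked_word \<Rightarrow> bool" where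
  "fresh_below i v \<longleftrightarrow> (\<forall>(j, s)\<in>set v. {j, j + 1} \<inter> {i - 1, i, i + 1} = {})"

inductive merge :: "marked_word \<Rightarrow> marked_word \<Rightarrow> bool" where
  "w \<simeq> u @ [(i, True), (i, False)] @ v \<Longrightarrow> merge w (u @ [(i, False)] @ v)"
| "w \<simeq> u @ [(i, False), (i, True)] @ v \<Longrightarrow> merge w (u @ [(i, False)] @ v)"

inductive move1 :: "marked_word \<Rightarrow> marked_word \<Rightarrow> bool" where
  "w \<simeq> u @ [(i - 1, True), (i, False), (i - 1, False)] @ v \<Longrightarrow> 2 \<le> i \<Longrightarrow>
   move1 w (u @ [(i, False), (i - 1, False), (i, True)] @ v)"

inductive move2 :: "marked_word \<Rightarrow> marked_word \<Rightarrow> bool" where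
  "w \<simeq> u @ [(i - 1, True), (i, False)] @ v \<Longrightarrow> 2 \<le> i \<Longrightarrow> fresh_below i v \<Longrightarrow>
   move2 w (u @ [(i, False), (i - 1, True)] @ v)"

inductive move3 :: "marked_word \<Rightarrow> marked_word \<Rightarrow> bool" where
  "w \<simeq> u @ [(i - 1, False), (i, True)] @ v \<Longrightarrow> 2 \<le> i \<Longrightarrow> fresh_below i v \<Longrightarrow>
   move3 w (u @ [(i, True), (i - 1, False)] @ v)"

inductive move4 :: "marked_word \<Rightarrow> marked_word \<Rightarrow> bool" where
  "w \<simeq> u @ [(i - 1, False), (i, False), (i - 1, True)] @ v \<Longrightarrow> 2 \<le> i \<Longrightarrow>
   move4 w (u @ [(i, True), (i - 1, False), (i, False)] @ v)"

text \<open>\<open>run n w w'\<close>: started at step n on w, the algorithm can terminate with w'.\<close>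

inductive run :: "nat \<Rightarrow> marked_word \<Rightarrow> marked_word \<Rightarrow> bool" where
  merge: "n \<in> {1..4} \<Longrightarrow> merge w w' \<Longrightarrow> run n w w'"
| step1: "\<nexists>x. merge w x \<Longrightarrow> move1 w w1 \<Longrightarrow> run 1 w1 w' \<Longrightarrow> run 1 w w'"
| skip1: "\<nexists>x. merge w x \<Longrightarrow> \<nexists>x. move1 w x \<Longrightarrow> run 2 w w' \<Longrightarrow> run 1 w w'"
| step2: "\<nexists>x. merge w x \<Longrightarrow> move2 w w1 \<Longrightarrow> run 3 w1 w' \<Longrightarrow> run 2 w w'"
| skip2: "\<nexists>x. merge w x \<Longrightarrow> \<nexists>x. move2 w x \<Longrightarrow> run 3 w w' \<Longrightarrow> run 2 w w'"
| step3: "\<nexists>x. merge w x \<Longrightarrow> move3 w w1 \<Longrightarrow> run 4 w1 w' \<Longrightarrow> run 3 w w'"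
| skip3: "\<nexists>x. merge w x \<Longrightarrow> \<nexists>x. move3 w x \<Longrightarrow> run 4 w w' \<Longrightarrow> run 3 w w'"
| step4: "\<nexists>x. merge w x \<Longrightarrow> move4 w w1 \<Longrightarrow> run 4 w1 w' \<Longrightarrow> run 4 w w'"
| stop4: "\<nexists>x. merge w x \<Longrightarrow> \<nexists>x. move4 w x \<Longrightarrow> run 4 w w"

definition unmarked :: "nat list \<Rightarrow> marked_word" where
  "unmarked w = map (\<lambda>j. (j, False)) w"

definition absorbs :: "nat \<Rightarrow> nat \<Rightarrow> layout \<Rightarrow> layout \<Rightarrow> bool" where
  "absorbs L q d d' \<longleftrightarrow> d' \<in> rsf_layouts L \<and>
     (\<exists>w. run 1 ((q, True) # unmarked (rsf_word d)) w \<and>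
          unmarked (map fst w) \<simeq> unmarked (rsf_word d'))"

text \<open>The outcome of the algorithm depends only on the layout d and the bond q.\<close>

definition absorb :: "nat \<Rightarrow> nat \<Rightarrow> layout \<Rightarrow> layout" where
  "absorb L q d = (THE d'. absorbs L q d d')"

section \<open>The unitary circuit game\<close>

definition removable :: "nat \<Rightarrow> nat \<Rightarrow> layout \<Rightarrow> layout \<Rightarrow> bool" where
  "removable L b d d' \<longleftrightarrow> d' \<in> rsf_layouts L \<and>
     length (rsf_word d) = Suc (length (rsf_word d')) \<and> absorb L b d' = d"

definition disentangle :: "nat \<Rightarrow> nat \<Rightarrow> layout \<Rightarrow> layout" where
  "disentangle L b d = (if \<exists>d'. removable L b d d' then THE d'. removable L b d d' else d)"

definition game_step :: "nat \<Rightarrow> real \<Rightarrow> layout \<Rightarrow> layout pmf" where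
  "game_step L p d =
     do { b \<leftarrow> pmf_of_set {1..L - 1};
          dis \<leftarrow> bernoulli_pmf p;
          return_pmf (if dis then disentangle L b d else absorb L b d) }"

primrec evolve :: "nat \<Rightarrow> real \<Rightarrow> layout \<Rightarrow> nat \<Rightarrow> layout pmf" where
  "evolve L p d 0 = return_pmf d"
| "evolve L p d (Suc n) = bind_pmf (evolve L p d n) (game_step L p)"

text \<open>The invariant distribution that is reached at late times from every initial layout.\<close>

definition is_stationary :: "nat \<Rightarrow> real \<Rightarrow> layout pmf \<Rightarrow> bool" where
  "is_stationary L p \<pi> \<longleftrightarrow> set_pmf \<pi> \<subseteq> rsf_layouts L \<and> bind_pmf \<pi> (game_step L p) = \<pi> \<and>
     (\<forall>d0\<in>rsf_layouts L. \<forall>d. (\<lambda>n. pmf (evolve L p d0 n) d) \<longlonglongrightarrow> pmf \<pi> d)"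

definition stationary :: "nat \<Rightarrow> real \<Rightarrow> layout pmf" where
  "stationary L p = (THE \<pi>. is_stationary L p \<pi>)"

text \<open>The average over the stationary distribution, where the layout d is represented by the
  circuit \<open>circ d\<close>. By genericity the choice of the representatives is immaterial.\<close>

definition mean_renyi0 :: "nat \<Rightarrow> real \<Rightarrow> (layout \<Rightarrow> circuit) \<Rightarrow> nat \<Rightarrow> real" where
  "mean_renyi0 L p circ m =
     measure_pmf.expectation (stationary L p) (\<lambda>d. renyi0 L m (circuit_state L (circ d)))"

end

theory Submission
  imports Defs "Jordan_Normal_Form.DL_Rank_Submatrix"
begin

text \<open>A layout encodes an involution of the qubits: the sequence \<open>(k, l)\<close> is an arc from \<open>k\<close> to \<open>k + l\<close>,
  where the labels of the later sequences are those of the points left over, shifted up by one below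
  \<open>k + l\<close>. The generic entropy at bond \<open>m\<close> is the number of arcs crossing \<open>m\<close>, and absorbing a gate
  at bond \<open>q\<close> acts as a generator of the 0-Hecke monoid by conjugation. When this adds a gate, the
  old involution can be recovered from the new one, so at \<open>p = 1/2\<close> the transition matrix is symmetric
  and the stationary distribution is uniform on all involutions of \<open>L\<close> points. Two given points are
  joined by \<open>I (L - 2)\<close> of the \<open>I L\<close> involutions, so the mean entropy is \<open>m (L - m) I (L - 2) / I L\<close>,
  where \<open>L I (L - 2) / I L\<close> tends to 1.

  The absorbed layout is unique because every step of the algorithm preserves the rank function of
  the permutation, which determines the layout.\<close>

section \<open>Layouts and the absorption map\<close>

text \<open>Merging, exchanging and steps 1 and 4 are relations of the 0-Hecke monoid, but steps 2
  and 3 hold only on the state 000: they exchange two neighbouring generators. Conjugation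
  accommodates them, because on three fixed points both orders lead to the reversal of these points,
  whereas multiplication on one side would tell the orders apart. This is why the invariant is an
  involution. Permutations as such do not appear: uniqueness is argued with rank functions,
  everything else with lists. Uniqueness alone does not show that the algorithm ends in a layout at
  all. Its steps are guarded by the failure of other steps, so an explicit run has to be given
  together with proofs, up to exchanges, that the skipped steps do not apply.
  \<open>stationary\<close> also demands convergence from every layout, for which symmetry is not
  enough. All layouts are connected through the empty one, where the disentangler idles, so paths
  can be padded to a common length.\<close>

fun layout_from :: "nat \<Rightarrow> nat \<Rightarrow> layout \<Rightarrow> bool" where
  "layout_from c L [] = True"
| "layout_from c L ((k, l) # d) \<longleftrightarrow> c \<le> k \<and> 1 \<le> l \<and> k + l \<le> L \<and> layout_from (k + 2) L d"

lemma layout_from_mono: "layout_from c L d \<Longrightarrow> c' \<le> c \<Longrightarrow> layout_from c' L d"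
  by (cases d) auto

lemma layout_from_iff:
  "layout_from c L d \<longleftrightarrow> (\<forall>(k, l)\<in>set d. c \<le> k \<and> 1 \<le> l \<and> k + l \<le> L)
     \<and> (\<forall>i. Suc i < length d \<longrightarrow> fst (d ! i) + 2 \<le> fst (d ! Suc i))"
proof (induction d arbitrary: c)
  case (Cons x d)
  obtain k l where x: "x = (k, l)" by fastforce
  have all_nat: "(\<forall>i. P i) \<longleftrightarrow> P 0 \<and> (\<forall>i. P (Suc i))" for P :: "nat \<Rightarrow> bool"
    by (metis nat.exhaust)
  have "(\<forall>i. Suc i < length (x # d) \<longrightarrow> fst ((x # d) ! i) + 2 \<le> fst ((x # d) ! Suc i)) \<longleftrightarrow>
     (d \<noteq> [] \<longrightarrow> k + 2 \<le> fst (d ! 0)) \<and>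
     (\<forall>i. Suc i < length d \<longrightarrow> fst (d ! i) + 2 \<le> fst (d ! Suc i))"
    by (subst all_nat) (simp add: x)
  moreover have "layout_from (k + 2) L d \<longleftrightarrow> layout_from c L d \<and> (d \<noteq> [] \<longrightarrow> k + 2 \<le> fst (d ! 0))"
    if "c \<le> k"
    using that by (cases d) auto
  ultimately show ?case
    using Cons.IH[of c] by (auto simp: x)
qed simp

text \<open>Starting bonds grow by at least two, which already bounds the number of sequences as the
  definition of \<open>rsf_layouts\<close> requires.\<close>

lemma length_layout_from: "layout_from c L d \<Longrightarrow> d = [] \<or> 2 * length d + c \<le> L + 1"
  by (induction c L d rule: layout_from.induct) auto

lemma rsf_layouts_eq: "rsf_layouts L = {d. layout_from 1 L d}"
proof -
  have "2 * length d \<le> L" if "layout_from 1 L d" for d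
    using length_layout_from[OF that] by auto
  then show ?thesis
    unfolding rsf_layouts_def layout_from_iff[of 1] by blast
qed

lemma rsf_word_simps [simp]:
  "rsf_word [] = []"
  "rsf_word ((k, l) # d) = rev [k..<k + l] @ rsf_word d"
  "rsf_word (d @ d') = rsf_word d @ rsf_word d'"
  by (simp_all add: rsf_word_def)

text \<open>The effect of absorbing a gate, read off from the algorithm. In terms of the involution, \<open>act q\<close>
  conjugates by the transposition of \<open>q\<close> and \<open>q + 1\<close> (or multiplies by it, if both points are fixed)
  whenever this increases the number of gates; in the last branch the two arcs starting at \<open>k\<close> and
  \<open>k + 1\<close> exchange their end points.\<close>

fun act :: "nat \<Rightarrow> layout \<Rightarrow> layout" where
  "act q [] = [(q, 1)]"
| "act q ((k, l) # d) =
    (if q + 2 \<le> k then (q, 1) # (k, l) # d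
     else if q + 1 = k then (q, l + 1) # d
     else if q = k + l then (k, l + 1) # d
     else if q + 1 = k + l then (k, l) # d
     else if k + l < q then (k, l) # act q d
     else if k < q then (k, l) # act (q + 1) d
     else (case d of [] \<Rightarrow> (k, l) # d
           | (k', l') # d' \<Rightarrow>
               if k' = k + 2 \<and> l \<le> l' + 1 then (k, l' + 2) # (k', l - 1) # d' else (k, l) # d))"

lemma layout_from_act:
  "layout_from c L d \<Longrightarrow> c \<le> q \<Longrightarrow> q < L \<Longrightarrow> layout_from c L (act q d)"
proof (induction q d arbitrary: c rule: act.induct)
  case (2 q k l d)
  then show ?case
    by (auto split: list.splits elim: layout_from_mono)
qed auto

text \<open>Intended for layouts that \<open>act q\<close> has changed. For \<open>q = k\<close> and
  \<open>l > 1\<close>, a next sequence starting at \<open>k + 2\<close> identifies the exchange of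
  end points: had \<open>act\<close> moved the start of a sequence from \<open>k + 1\<close> down to
  \<open>k\<close>, the next one would start at \<open>k + 3\<close> or later.\<close>

fun deact :: "nat \<Rightarrow> layout \<Rightarrow> layout" where
  "deact q [] = []"
| "deact q ((k, l) # d) =
    (if q = k then
       (if l = 1 then d
        else case d of [] \<Rightarrow> [(k + 1, l - 1)]
             | (k', l') # d' \<Rightarrow>
                 if k' = k + 2 then (k, l' + 1) # (k', l - 2) # d' else (k + 1, l - 1) # d)
     else if q + 1 = k + l then (k, l - 1) # d
     else if k + l < q then (k, l) # deact q d
     else (k, l) # deact (q + 1) d)"

text \<open>Since \<open>act q\<close> can be inverted wherever it changes something, a layout has
  at most one proper predecessor per bond; this makes the \<open>THE\<close> in
  \<open>disentangle\<close> meaningful.\<close>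

lemma deact_act: "layout_from c L d \<Longrightarrow> act q d \<noteq> d \<Longrightarrow> deact q (act q d) = d"
proof (induction q d arbitrary: c rule: act.induct)
  case (2 q k l d)
  consider "q + 2 \<le> k" | "q + 1 = k" | "q = k + l" | "q + 1 = k + l" "q \<ge> k" | "k + l < q"
    | "k < q" "q + 1 < k + l" | "q = k" "q + 1 < k + l"
    by linarith
  then show ?case
  proof cases
    case 5
    then show ?thesis using 2 by (cases d) (auto split: if_splits)
  next
    case 6
    then show ?thesis using 2 by (cases d) (auto split: if_splits)
  next
    case 7
    then show ?thesis using 2 by (cases d) (auto split: if_splits)
  qed (use 2 in \<open>auto split: list.splits\<close>)
qed auto

lemma length_act:
  "layout_from c L d \<Longrightarrow> act q d \<noteq> d \<Longrightarrow> length (rsf_word (act q d)) = Suc (length (rsf_word d))"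
proof (induction q d arbitrary: c rule: act.induct)
  case (2 q k l d)
  consider "q + 2 \<le> k" | "q + 1 = k" | "q = k + l" | "q + 1 = k + l" "q \<ge> k" | "k + l < q"
    | "k < q" "q + 1 < k + l" | "q = k" "q + 1 < k + l"
    by linarith
  then show ?case
  proof cases
    case 5
    then show ?thesis using 2 by (cases d) (auto split: if_splits)
  next
    case 6
    then show ?thesis using 2 by (cases d) (auto split: if_splits)
  next
    case 7
    then show ?thesis using 2 by (cases d) (auto split: if_splits)
  qed (use 2 in \<open>auto split: list.splits\<close>)
qed auto

text \<open>Bond \<open>k\<close> opens the sequence and each further bond extends it at the top.
  Over a whole word this reaches every layout from the empty one by absorptions, which later gives
  irreducibility.\<close>

lemma fold_act_upt:
  assumes "layout_from (k + 2) L d"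
  shows "foldr act (rev [k..<k + l]) d = (if l = 0 then d else (k, l) # d)"
  using assms
proof (induction l)
  case (Suc l)
  have "foldr act (rev [k..<k + Suc l]) d = act (k + l) (foldr act (rev [k..<k + l]) d)"
    by simp
  then show ?case
    using Suc by (cases d) auto
qed simp

lemma foldr_act_rsf_word: "layout_from c L d \<Longrightarrow> foldr act (rsf_word d) [] = d"
proof (induction c L d rule: layout_from.induct)
  case (2 c L k l d)
  then have "foldr act (rsf_word ((k, l) # d)) [] = foldr act (rev [k..<k + l]) d"
    by simp
  then show ?case using fold_act_upt[of k L d l] 2 by auto
qed simp

section \<open>Rank functions\<close>

text \<open>A permutation \<open>\<sigma>\<close> is encoded by \<open>r a b\<close>, the number of points \<open>x \<le> a\<close> with \<open>\<sigma> x > b\<close>. In this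
  encoding, sorting two neighbouring values (or positions) into descending order is a min-plus linear
  operation on the rows (or columns), which makes the relations between the operations easy to check.\<close>

type_synonym rank_fun = "int \<Rightarrow> int \<Rightarrow> int"

definition row_op :: "int \<Rightarrow> rank_fun \<Rightarrow> rank_fun" where
  "row_op q r = (\<lambda>a b. if a = q then min (r (q - 1) b + 1) (r (q + 1) b) else r a b)"

definition col_op :: "int \<Rightarrow> rank_fun \<Rightarrow> rank_fun" where
  "col_op q r = (\<lambda>a b. if b = q then min (r a (q + 1) + 1) (r a (q - 1)) else r a b)"

definition conj_op :: "nat \<Rightarrow> rank_fun \<Rightarrow> rank_fun" where
  "conj_op q r = col_op (int q) (row_op (int q) r)"

text \<open>\<open>max 0 (a - b)\<close> is the rank function of the identity on all integers, so no
  bond is a boundary case.\<close>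

definition rank_of :: "nat list \<Rightarrow> rank_fun" where
  "rank_of w = foldr conj_op w (\<lambda>a b. max 0 (a - b))"

lemma rank_of_simps [simp]:
  "rank_of [] = (\<lambda>a b. max 0 (a - b))"
  "rank_of (q # w) = conj_op q (rank_of w)"
  by (simp_all add: rank_of_def)

lemma rank_of_append: "rank_of (u @ v) = foldr conj_op u (rank_of v)"
  by (simp add: rank_of_def)

text \<open>Each point contributes at most one to a rank. The braid relation uses no other property
  of permutations.\<close>

definition unit_steps :: "rank_fun \<Rightarrow> bool" where
  "unit_steps r \<longleftrightarrow> (\<forall>a b. r a b \<le> r (a + 1) b \<and> r (a + 1) b \<le> r a b + 1 \<and>
     r a (b + 1) \<le> r a b \<and> r a b \<le> r a (b + 1) + 1)"

lemma row_col_commute: "col_op p (row_op q r) = row_op q (col_op p r)"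
  by (auto simp: row_op_def col_op_def fun_eq_iff)

lemma unit_steps_row_op:
  assumes "unit_steps r"
  shows "unit_steps (row_op q r)"
proof -
  have r: "r a b \<le> r (a + 1) b" "r (a + 1) b \<le> r a b + 1" "r a (b + 1) \<le> r a b"
    "r a b \<le> r a (b + 1) + 1" for a b
    using assms by (auto simp: unit_steps_def)
  show ?thesis
    unfolding unit_steps_def
  proof (intro allI)
    fix a b
    have "row_op q r a b \<le> row_op q r (a + 1) b \<and> row_op q r (a + 1) b \<le> row_op q r a b + 1"
    proof -
      consider "a = q" | "a = q - 1" | "a \<noteq> q" "a \<noteq> q - 1" by linarith
      then show ?thesis
        using r(1,2)[of "q - 1" b] r(1,2)[of q b] r(1,2)[of a b]
        by cases (auto simp: row_op_def)
    qed
    moreover have "row_op q r a (b + 1) \<le> row_op q r a b \<and> row_op q r a b \<le> row_op q r a (b + 1) + 1"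
      using r(3,4)[of "q - 1" b] r(3,4)[of "q + 1" b] r(3,4)[of a b] by (auto simp: row_op_def)
    ultimately show "row_op q r a b \<le> row_op q r (a + 1) b \<and> row_op q r (a + 1) b \<le> row_op q r a b + 1 \<and>
       row_op q r a (b + 1) \<le> row_op q r a b \<and> row_op q r a b \<le> row_op q r a (b + 1) + 1" by simp
  qed
qed

text \<open>The reflection of \<open>(a, b)\<close> to \<open>(- b, - a)\<close> exchanges rows and
  columns and transfers unit steps from one to the other.\<close>

lemma col_op_eq_row_op: "col_op q r = (\<lambda>a b. row_op (- q) (\<lambda>b a. r (- a) (- b)) (- b) (- a))"
  by (auto simp: row_op_def col_op_def fun_eq_iff add.commute)

lemma unit_steps_flip: "unit_steps r \<Longrightarrow> unit_steps (\<lambda>b a. r (- a) (- b))"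
  unfolding unit_steps_def
proof (intro allI)
  fix a b
  assume *: "\<forall>a b. r a b \<le> r (a + 1) b \<and> r (a + 1) b \<le> r a b + 1 \<and>
     r a (b + 1) \<le> r a b \<and> r a b \<le> r a (b + 1) + 1"
  show "r (- b) (- a) \<le> r (- b) (- (a + 1)) \<and> r (- b) (- (a + 1)) \<le> r (- b) (- a) + 1 \<and>
       r (- (b + 1)) (- a) \<le> r (- b) (- a) \<and> r (- b) (- a) \<le> r (- (b + 1)) (- a) + 1"
    using *[rule_format, of "- b" "- (a + 1)"] *[rule_format, of "- (b + 1)" "- a"] by simp
qed

lemma unit_steps_conj_op: "unit_steps r \<Longrightarrow> unit_steps (conj_op q r)"
  unfolding conj_op_def
  by (subst col_op_eq_row_op)
    (use unit_steps_flip[OF unit_steps_row_op[OF unit_steps_flip[OF unit_steps_row_op]]] in simp)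

lemma unit_steps_rank_of: "unit_steps (rank_of w)"
proof (induction w)
  case Nil
  show ?case by (auto simp: unit_steps_def)
qed (simp add: unit_steps_conj_op)

section \<open>Relations between the conjugation operators\<close>

lemma row_op_idem: "row_op q (row_op q r) = row_op q r"
  by (auto simp: row_op_def fun_eq_iff)

lemma col_op_idem: "col_op q (col_op q r) = col_op q r"
  by (auto simp: col_op_def fun_eq_iff)

lemma conj_op_idem: "conj_op q (conj_op q r) = conj_op q r"
  unfolding conj_op_def row_col_commute by (simp add: row_op_idem col_op_idem flip: row_col_commute)

lemma row_op_commute: "i + 2 \<le> j \<or> j + 2 \<le> i \<Longrightarrow> row_op i (row_op j r) = row_op j (row_op i r)"
  by (auto simp: row_op_def fun_eq_iff)

lemma col_op_commute: "i + 2 \<le> j \<or> j + 2 \<le> i \<Longrightarrow> col_op i (col_op j r) = col_op j (col_op i r)"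
  by (auto simp: col_op_def fun_eq_iff)

lemma conj_op_commute:
  assumes "i + 2 \<le> j \<or> j + 2 \<le> i"
  shows "conj_op i (conj_op j r) = conj_op j (conj_op i r)"
proof -
  have "int i + 2 \<le> int j \<or> int j + 2 \<le> int i" using assms by linarith
  note row_op_commute[OF this] col_op_commute[OF this]
  then show ?thesis unfolding conj_op_def by (simp flip: row_col_commute)
qed

text \<open>With \<open>A, B, C, D\<close> for the rows \<open>i - 2\<close> to
  \<open>i + 1\<close>, both sides have \<open>min (A + 1) D\<close> and
  \<open>min (A + 2) D\<close> as the two middle rows; the unit steps make the terms in
  \<open>B\<close> and \<open>C\<close> redundant.\<close>

lemma row_op_braid:
  assumes "unit_steps r"
  shows "row_op (i - 1) (row_op i (row_op (i - 1) r)) = row_op i (row_op (i - 1) (row_op i r))"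
proof (intro ext)
  fix a b
  have r: "r a b \<le> r (a + 1) b" "r (a + 1) b \<le> r a b + 1" for a b
    using assms by (auto simp: unit_steps_def)
  show "row_op (i - 1) (row_op i (row_op (i - 1) r)) a b = row_op i (row_op (i - 1) (row_op i r)) a b"
    using r[of "i - 2" b] r[of "i - 1" b] r[of i b] by (auto simp: row_op_def)
qed

lemma col_op_braid:
  assumes "unit_steps r"
  shows "col_op (i - 1) (col_op i (col_op (i - 1) r)) = col_op i (col_op (i - 1) (col_op i r))"
proof (intro ext)
  fix a b
  have r: "r a (b + 1) \<le> r a b" "r a b \<le> r a (b + 1) + 1" for a b
    using assms by (auto simp: unit_steps_def)
  show "col_op (i - 1) (col_op i (col_op (i - 1) r)) a b = col_op i (col_op (i - 1) (col_op i r)) a b"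
    using r[of a "i - 2"] r[of a "i - 1"] r[of a i] by (auto simp: col_op_def)
qed

lemma conj_op_braid:
  assumes "unit_steps r" "1 \<le> i"
  shows "conj_op (i - 1) (conj_op i (conj_op (i - 1) r)) = conj_op i (conj_op (i - 1) (conj_op i r))"
proof -
  have i: "int (i - 1) = int i - 1" using assms by simp
  have "unit_steps (row_op (int i) (row_op (int i - 1) (row_op (int i) r)))"
    by (intro unit_steps_row_op assms)
  from col_op_braid[OF this, of "int i"] show ?thesis
    unfolding conj_op_def i by (simp add: row_op_braid[OF assms(1)] flip: row_col_commute)
qed

text \<open>The rank function of a permutation that fixes the three points \<open>c + 1\<close>, \<open>c + 2\<close>, \<open>c + 3\<close>.\<close>

definition fixes_triple :: "int \<Rightarrow> rank_fun \<Rightarrow> bool" where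
  "fixes_triple c r \<longleftrightarrow>
     (\<forall>a b. c \<le> a \<longrightarrow> a \<le> c + 3 \<longrightarrow> c \<le> b \<longrightarrow> b \<le> c + 3 \<longrightarrow> r a b = max 0 (a - b)) \<and>
     (\<forall>a b. c \<le> a \<longrightarrow> a \<le> c + 2 \<longrightarrow> b \<le> c \<longrightarrow> r (a + 1) b = r a b + 1) \<and>
     (\<forall>a b. c \<le> a \<longrightarrow> a \<le> c + 2 \<longrightarrow> c + 3 \<le> b \<longrightarrow> r (a + 1) b = r a b) \<and>
     (\<forall>a b. c \<le> b \<longrightarrow> b \<le> c + 2 \<longrightarrow> a \<le> c \<longrightarrow> r a (b + 1) = r a b) \<and>
     (\<forall>a b. c \<le> b \<longrightarrow> b \<le> c + 2 \<longrightarrow> c + 3 \<le> a \<longrightarrow> r a (b + 1) = r a b - 1)"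

lemma fixes_triple_row_op:
  assumes "fixes_triple c r" "q < c \<or> c + 3 < q"
  shows "fixes_triple c (row_op q r)"
proof -
  note r = assms(1)[unfolded fixes_triple_def, rule_format]
  note r1 = r[THEN conjunct1, rule_format] and r2 = r[THEN conjunct2, THEN conjunct1, rule_format]
    and r3 = r[THEN conjunct2, THEN conjunct2, THEN conjunct1, rule_format]
    and r4 = r[THEN conjunct2, THEN conjunct2, THEN conjunct2, THEN conjunct1, rule_format]
    and r5 = r[THEN conjunct2, THEN conjunct2, THEN conjunct2, THEN conjunct2, rule_format]
  show ?thesis
    using assms(2) unfolding fixes_triple_def row_op_def
    by (intro conjI allI impI) (auto simp: r1 r2 r3 r4 r5)
qed

lemma fixes_triple_col_op:
  assumes "fixes_triple c r" "q < c \<or> c + 3 < q"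
  shows "fixes_triple c (col_op q r)"
proof -
  note r = assms(1)[unfolded fixes_triple_def, rule_format]
  note r1 = r[THEN conjunct1, rule_format] and r2 = r[THEN conjunct2, THEN conjunct1, rule_format]
    and r3 = r[THEN conjunct2, THEN conjunct2, THEN conjunct1, rule_format]
    and r4 = r[THEN conjunct2, THEN conjunct2, THEN conjunct2, THEN conjunct1, rule_format]
    and r5 = r[THEN conjunct2, THEN conjunct2, THEN conjunct2, THEN conjunct2, rule_format]
  show ?thesis
    using assms(2) unfolding fixes_triple_def col_op_def
    by (intro conjI allI impI) (auto simp: r1 r2 r3 r4 r5)
qed

lemma fixes_triple_rank_of:
  assumes "\<And>j. j \<in> set w \<Longrightarrow> {j, j + 1} \<inter> {i - 1, i, i + 1} = {}" "2 \<le> i"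
  shows "fixes_triple (int i - 2) (rank_of w)"
  using assms(1)
proof (induction w)
  case Nil
  show ?case by (auto simp: fixes_triple_def)
next
  case (Cons q w)
  have "q + 3 \<le> i \<or> i + 2 \<le> q"
    using Cons.prems[of q] assms(2) by auto
  then have q: "int q < int i - 2 \<or> int i - 2 + 3 < int q" by linarith
  have "fixes_triple (int i - 2) (rank_of w)" using Cons by auto
  then show ?case
    using q unfolding rank_of_simps conj_op_def
    by (intro fixes_triple_row_op fixes_triple_col_op)
qed

text \<open>Either order of conjugation turns the identity on \<open>c + 1, c + 2, c + 3\<close>
  into the reversal of the three points. Outside this block the ranks along the triple are linear or
  constant, and the operations leave them unchanged.\<close>

lemma conj_op_fresh:
  assumes "fixes_triple (int i - 2) r" "2 \<le> i"
  shows "conj_op (i - 1) (conj_op i r) = conj_op i (conj_op (i - 1) r)"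
proof -
  define c where "c = int i - 2"
  have i: "int i = c + 2" "int (i - 1) = c + 1" using assms by (auto simp: c_def)
  have blk: "r a b = max 0 (a - b)" if "c \<le> a" "a \<le> c + 3" "c \<le> b" "b \<le> c + 3" for a b
    using assms(1) that unfolding fixes_triple_def c_def by simp
  have lo: "r (c + 1) b = r c b + 1" "r (c + 2) b = r c b + 2" "r (c + 3) b = r c b + 3" if "b \<le> c" for b
  proof -
    have "r (a + 1) b = r a b + 1" if "c \<le> a" "a \<le> c + 2" for a
      using assms(1) that \<open>b \<le> c\<close> unfolding fixes_triple_def c_def by simp
    from this[of c] this[of "c + 1"] this[of "c + 2"]
    show "r (c + 1) b = r c b + 1" "r (c + 2) b = r c b + 2" "r (c + 3) b = r c b + 3" by (simp_all add: add.commute)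
  qed
  have hi: "r (c + 1) b = r c b" "r (c + 2) b = r c b" "r (c + 3) b = r c b" if "c + 3 \<le> b" for b
  proof -
    have "r (a + 1) b = r a b" if "c \<le> a" "a \<le> c + 2" for a
      using assms(1) that \<open>c + 3 \<le> b\<close> unfolding fixes_triple_def c_def by simp
    from this[of c] this[of "c + 1"] this[of "c + 2"]
    show "r (c + 1) b = r c b" "r (c + 2) b = r c b" "r (c + 3) b = r c b" by (simp_all add: add.commute)
  qed
  have lo': "r a (c + 1) = r a c" "r a (c + 2) = r a c" "r a (c + 3) = r a c" if "a \<le> c" for a
  proof -
    have "r a (b + 1) = r a b" if "c \<le> b" "b \<le> c + 2" for b
      using assms(1) that \<open>a \<le> c\<close> unfolding fixes_triple_def c_def by simp
    from this[of c] this[of "c + 1"] this[of "c + 2"]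
    show "r a (c + 1) = r a c" "r a (c + 2) = r a c" "r a (c + 3) = r a c" by (simp_all add: add.commute)
  qed
  have hi': "r a c = r a (c + 3) + 3" "r a (c + 1) = r a (c + 3) + 2" "r a (c + 2) = r a (c + 3) + 1"
    if "c + 3 \<le> a" for a
  proof -
    have "r a (b + 1) = r a b - 1" if "c \<le> b" "b \<le> c + 2" for b
      using assms(1) that \<open>c + 3 \<le> a\<close> unfolding fixes_triple_def c_def by simp
    from this[of c] this[of "c + 1"] this[of "c + 2"]
    show "r a c = r a (c + 3) + 3" "r a (c + 1) = r a (c + 3) + 2" "r a (c + 2) = r a (c + 3) + 1"
      by (simp_all add: add.commute)
  qed
  have "col_op (c + 1) (col_op (c + 2) (row_op (c + 1) (row_op (c + 2) r))) a b =
        col_op (c + 2) (col_op (c + 1) (row_op (c + 2) (row_op (c + 1) r))) a b" for a b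
  proof -
    consider "b \<le> c" | "c + 3 \<le> b" | "a \<le> c" | "c + 3 \<le> a"
      | "a \<in> {c + 1, c + 2}" "b \<in> {c + 1, c + 2}"
      by force
    then show ?thesis
    proof cases
      case 1
      then show ?thesis by (auto simp: row_op_def col_op_def lo lo[unfolded add.commute[of c]])
    next
      case 2
      then show ?thesis by (auto simp: row_op_def col_op_def hi hi[unfolded add.commute[of c]])
    next
      case 3
      then show ?thesis by (auto simp: row_op_def col_op_def lo' lo'[unfolded add.commute[of c]])
    next
      case 4
      then show ?thesis by (auto simp: row_op_def col_op_def hi' hi'[unfolded add.commute[of c]] add.commute)
    next
      case 5
      then show ?thesis by (auto simp: row_op_def col_op_def blk)
    qed
  qed
  then show ?thesis
    unfolding conj_op_def i by (intro ext) (simp flip: row_col_commute)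
qed

section \<open>Recovering a layout from its rank function\<close>

definition near_id :: "int \<Rightarrow> rank_fun \<Rightarrow> bool" where
  "near_id c r \<longleftrightarrow> (\<forall>a b. a < c \<or> b < c \<longrightarrow> r a b = max 0 (a - b))"

lemma near_id_rank_of: "(\<And>q. q \<in> set w \<Longrightarrow> c \<le> q) \<Longrightarrow> near_id (int c) (rank_of w)"
proof (induction w)
  case Nil
  show ?case by (simp add: near_id_def)
next
  case (Cons q w)
  then have r: "near_id (int c) (rank_of w)" and q: "int c \<le> int q" by auto
  have "near_id (int c) (row_op (int q) (rank_of w))"
    using r q unfolding near_id_def row_op_def by auto
  then have "near_id (int c) (col_op (int q) (row_op (int q) (rank_of w)))"
    using q unfolding near_id_def col_op_def by auto
  then show ?case by (simp add: conj_op_def)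
qed

lemma rsf_word_ge: "layout_from c L d \<Longrightarrow> \<forall>q\<in>set (rsf_word d). c \<le> q"
proof (induction c L d rule: layout_from.induct)
  case (2 c L k l d)
  then show ?case by fastforce
qed simp

lemma near_id_rsf: "layout_from c L d \<Longrightarrow> near_id (int c) (rank_of (rsf_word d))"
  using near_id_rank_of rsf_word_ge by blast

text \<open>Inserting the arc from \<open>k\<close> to \<open>k + l\<close> into an involution of the remaining points; the
  new rank function is that of the old one with the labels of the points in between shifted.\<close>

definition insert_arc :: "int \<Rightarrow> int \<Rightarrow> rank_fun \<Rightarrow> rank_fun" where
  "insert_arc k l r = (\<lambda>a b. if a < k \<or> b < k then max 0 (a - b)
     else r (if a < k + l then a + 1 else a) (if b < k + l then b + 1 else b)
       + (if b < k + l then 1 else 0))"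

text \<open>An arc of length 0 is the fixed point \<open>k\<close>. The gate on bond
  \<open>q = k + l\<close> then moves the end point from \<open>q\<close> to \<open>q + 1\<close>:
  first in the rows, which gives \<open>H\<close>, then in the columns.\<close>

lemma rank_of_insert_arc:
  assumes "unit_steps r" "near_id (int k + 2) r"
  shows "foldr conj_op (rev [k..<k + l]) r = insert_arc (int k) (int l) r"
proof (induction l)
  case 0
  then show ?case using assms(2) by (auto simp: insert_arc_def near_id_def fun_eq_iff)
next
  case (Suc l)
  define K where "K = int k"
  define q where "q = K + int l"
  define H where "H = row_op q (insert_arc K (int l) r)"
  have r: "r a b \<le> r (a + 1) b" "r (a + 1) b \<le> r a b + 1" "r a (b + 1) \<le> r a b"
    "r a b \<le> r a (b + 1) + 1" for a b
    using assms(1) by (auto simp: unit_steps_def)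
  have n: "r a b = max 0 (a - b)" if "a < K + 2 \<or> b < K + 2" for a b
    using assms(2) that by (auto simp: near_id_def K_def)
  have H: "H a b = (if a < K \<or> b < K then max 0 (a - b)
     else r (if a < q + 1 then a + 1 else a) (if b < q then b + 1 else b) + (if b < q then 1 else 0))" for a b
  proof (cases "a = q \<and> K \<le> b")
    case True
    show ?thesis
    proof (cases "l = 0")
      case True
      then show ?thesis using \<open>a = q \<and> K \<le> b\<close> n[of "K + 1" b]
        by (auto simp: H_def row_op_def insert_arc_def q_def)
    next
      case False
      then show ?thesis
        using \<open>a = q \<and> K \<le> b\<close> r(2)[of q "if b < q then b + 1 else b"]
        by (auto simp: H_def row_op_def insert_arc_def q_def)
    qed
  next
    case False
    then show ?thesis by (auto simp: H_def row_op_def insert_arc_def q_def)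
  qed
  have "col_op q H = insert_arc K (int (Suc l)) r"
  proof (intro ext)
    fix a b
    show "col_op q H a b = insert_arc K (int (Suc l)) r a b"
    proof (cases "b = q \<and> K \<le> a")
      case True
      show ?thesis
      proof (cases "l = 0")
        case True
        then show ?thesis using \<open>b = q \<and> K \<le> a\<close> n[of "K + 1" "K + 1"] n[of a "K + 1"]
          by (auto simp: col_op_def H insert_arc_def q_def)
      next
        case False
        then show ?thesis
          using \<open>b = q \<and> K \<le> a\<close> r(3)[of "if a < q + 1 then a + 1 else a" q]
          by (auto simp: col_op_def H insert_arc_def q_def)
      qed
    next
      case False
      then show ?thesis by (auto simp: col_op_def H insert_arc_def q_def)
    qed
  qed
  then show ?case
    using Suc by (simp add: conj_op_def H_def K_def q_def)
qed

lemma rank_of_rsf_Cons: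
  assumes "layout_from (k + 2) L d"
  shows "rank_of (rsf_word ((k, l) # d)) = insert_arc (int k) (int l) (rank_of (rsf_word d))"
  using rank_of_insert_arc[OF unit_steps_rank_of, of k "rsf_word d" l] near_id_rsf[OF assms]
  by (simp add: rank_of_append add.commute)

text \<open>All points below \<open>k\<close> are fixed, so row \<open>k\<close> sees only the image
  of \<open>k\<close>, which is \<open>k + l\<close>.\<close>

lemma insert_arc_diag:
  assumes "near_id (k + 2) r" "1 \<le> l" "k \<le> b"
  shows "insert_arc k l r k b = (if b < k + l then 1 else 0)"
  using assms by (auto simp: insert_arc_def near_id_def)

text \<open>The smallest point that is not fixed gives \<open>k\<close>, its image gives
  \<open>l\<close>, and \<open>insert_arc\<close> is undone for the tail. Agreement is assumed from
  \<open>c\<close> on only, since undoing \<open>insert_arc\<close> says nothing about indices below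
  \<open>k\<close>.\<close>

lemma rsf_word_inj_aux:
  assumes "layout_from c L d" "layout_from c L' d'"
    and "\<And>a b. int c \<le> a \<Longrightarrow> int c \<le> b \<Longrightarrow> rank_of (rsf_word d) a b = rank_of (rsf_word d') a b"
  shows "d = d'"
  using assms
proof (induction c L d arbitrary: d' rule: layout_from.induct)
  case (1 c L)
  show ?case
  proof (cases d')
    case (Cons x d2)
    obtain k l where x: "x = (k, l)" by fastforce
    have d2: "layout_from (k + 2) L' d2" "c \<le> k" "1 \<le> l" using 1 Cons x by auto
    have "rank_of (rsf_word d') (int k) (int k) = 1"
      unfolding Cons x rank_of_rsf_Cons[OF d2(1)]
      using insert_arc_diag near_id_rsf[OF d2(1)] d2(3) by (simp add: add.commute)
    then show ?thesis using 1(3)[of "int k" "int k"] d2(2) by simp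
  qed simp
next
  case (2 c L k l d)
  have d: "layout_from (k + 2) L d" "c \<le> k" "1 \<le> l" using 2 by auto
  have diag: "rank_of (rsf_word ((k, l) # d)) (int k) b = (if b < int k + int l then 1 else 0)"
    if "int k \<le> b" for b
    unfolding rank_of_rsf_Cons[OF d(1)]
    using insert_arc_diag[of "int k" _ "int l" b] near_id_rsf[OF d(1)] d(3) that by (simp add: add.commute)
  show ?case
  proof (cases d')
    case Nil
    then show ?thesis using 2(4)[of "int k" "int k"] diag[of "int k"] d by simp
  next
    case (Cons x d2)
    obtain k' l' where x: "x = (k', l')" by fastforce
    have d2: "layout_from (k' + 2) L' d2" "c \<le> k'" "1 \<le> l'" using 2 Cons x by auto
    have diag': "rank_of (rsf_word d') (int k') b = (if b < int k' + int l' then 1 else 0)"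
      if "int k' \<le> b" for b
      unfolding Cons x rank_of_rsf_Cons[OF d2(1)]
      using insert_arc_diag[of "int k'" _ "int l'" b] near_id_rsf[OF d2(1)] d2(3) that
      by (simp add: add.commute)
    have "layout_from k L ((k, l) # d)" "layout_from k' L' d'"
      using 2 Cons x by auto
    note n = near_id_rsf[OF this(1), unfolded near_id_def, rule_format]
      near_id_rsf[OF this(2), unfolded near_id_def, rule_format]
    have k: "k = k'"
    proof (rule linorder_cases[of k k'])
      assume "k < k'"
      then show ?thesis
        using n(2)[of "int k" "int k"] diag[of "int k"] 2(4)[of "int k" "int k"] d by simp
    next
      assume "k' < k"
      then show ?thesis
        using n(1)[of "int k'" "int k'"] diag'[of "int k'"] 2(4)[of "int k'" "int k'"] d2 by simp
    qed
    have l: "l = l'"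
    proof (rule linorder_cases[of l l'])
      assume "l < l'"
      then show ?thesis
        using diag[of "int k + int l"] diag'[of "int k + int l"] 2(4)[of "int k" "int k + int l"] d k
        by simp
    next
      assume "l' < l"
      then show ?thesis
        using diag[of "int k + int l'"] diag'[of "int k + int l'"] 2(4)[of "int k" "int k + int l'"] d k
        by simp
    qed
    have "d = d2"
    proof (rule 2(1)[OF d(1)])
      show "layout_from (k + 2) L' d2" using d2(1) k by simp
      fix a b assume ab: "int (k + 2) \<le> a" "int (k + 2) \<le> b"
      \<comment> \<open>On indices above \<open>k + 1\<close>, \<open>s\<close> is a right inverse
        of the label shift in \<open>insert_arc\<close>.\<close>
      define s where "s x = (if x \<le> int k + int l then x - 1 else x)" for x
      have "insert_arc (int k) (int l) (rank_of (rsf_word d)) (s a) (s b) =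
            insert_arc (int k) (int l) (rank_of (rsf_word d2)) (s a) (s b)"
        using 2(4)[of "s a" "s b"] ab d(2) rank_of_rsf_Cons[OF d(1), of l]
          rank_of_rsf_Cons[OF d2(1), of l'] Cons x k l
        by (auto simp: s_def)
      then show "rank_of (rsf_word d) a b = rank_of (rsf_word d2) a b"
        using ab by (auto simp: insert_arc_def s_def split: if_splits)
    qed
    then show ?thesis using Cons x k l by simp
  qed
qed

lemma rank_of_rsf_word_inj:
  assumes "layout_from c L d" "layout_from c L' d'" "rank_of (rsf_word d) = rank_of (rsf_word d')"
  shows "d = d'"
  using rsf_word_inj_aux[OF assms(1,2)] assms(3) by simp

section \<open>Invariance under the steps of the algorithm\<close>

lemma rank_of_exchange: "w \<simeq> w' \<Longrightarrow> rank_of (map fst w) = rank_of (map fst w')"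
proof (induction rule: rtranclp_induct)
  case (step x y)
  from step(2) have "rank_of (map fst x) = rank_of (map fst y)"
    by cases (auto simp: rank_of_append conj_op_commute)
  then show ?case using step by simp
qed simp

lemma rank_of_merge: "merge w w' \<Longrightarrow> rank_of (map fst w') = rank_of (map fst w)"
  by (induction rule: merge.induct)
    (auto dest!: rank_of_exchange simp: rank_of_append conj_op_idem)

lemma rank_of_move1: "move1 w w' \<Longrightarrow> rank_of (map fst w') = rank_of (map fst w)"
  by (induction rule: move1.induct)
    (use conj_op_braid in \<open>auto dest!: rank_of_exchange simp: rank_of_append unit_steps_rank_of\<close>)

lemma rank_of_move4: "move4 w w' \<Longrightarrow> rank_of (map fst w') = rank_of (map fst w)"
  by (induction rule: move4.induct)
    (use conj_op_braid in \<open>auto dest!: rank_of_exchange simp: rank_of_append unit_steps_rank_of\<close>)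

lemma conj_op_fresh_below:
  assumes "fresh_below i v" "2 \<le> i"
  shows "conj_op (i - 1) (conj_op i (rank_of (map fst v))) = conj_op i (conj_op (i - 1) (rank_of (map fst v)))"
  using assms(1) by (intro conj_op_fresh fixes_triple_rank_of assms(2)) (auto simp: fresh_below_def)

lemma rank_of_move2: "move2 w w' \<Longrightarrow> rank_of (map fst w') = rank_of (map fst w)"
  by (induction rule: move2.induct)
    (use conj_op_fresh_below in \<open>auto dest!: rank_of_exchange simp: rank_of_append\<close>)

lemma rank_of_move3: "move3 w w' \<Longrightarrow> rank_of (map fst w') = rank_of (map fst w)"
  by (induction rule: move3.induct)
    (use conj_op_fresh_below in \<open>auto dest!: rank_of_exchange simp: rank_of_append\<close>)

lemma rank_of_run: "run n w w' \<Longrightarrow> rank_of (map fst w') = rank_of (map fst w)"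
  by (induction rule: run.induct)
    (simp_all add: rank_of_merge rank_of_move1 rank_of_move2 rank_of_move3 rank_of_move4)

lemma map_fst_unmarked [simp]: "map fst (unmarked w) = w"
  by (simp add: unmarked_def comp_def)

lemma absorbs_unique:
  assumes "absorbs L q d d1" "absorbs L q d d2"
  shows "d1 = d2"
proof -
  have "rank_of (rsf_word d') = rank_of (q # rsf_word d)" if "absorbs L q d d'" for d'
  proof -
    from that obtain w where w: "run 1 ((q, True) # unmarked (rsf_word d)) w"
      "unmarked (map fst w) \<simeq> unmarked (rsf_word d')"
      by (auto simp: absorbs_def)
    from rank_of_run[OF w(1)] rank_of_exchange[OF w(2)] show ?thesis by simp
  qed
  then show ?thesis
    using assms rank_of_rsf_word_inj[of 1 L d1 L d2] by (simp add: absorbs_def rsf_layouts_eq)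
qed

section \<open>Simulation of the absorption algorithm\<close>

definition at_bonds :: "nat \<Rightarrow> nat \<Rightarrow> bool" where
  "at_bonds i j \<longleftrightarrow> j = i \<or> j = Suc i"

lemma exchange_sym: "w \<simeq> w' \<Longrightarrow> w' \<simeq> w"
proof (induction rule: rtranclp_induct)
  case (step x y)
  from step(2) have "exchange y x"
    by cases (use exchange.intros in blast)
  then show ?case using step(3) by (rule converse_rtranclp_into_rtranclp)
qed simp

lemma exchange_context: "w \<simeq> w' \<Longrightarrow> u @ w @ v \<simeq> u @ w' @ v"
proof (induction rule: rtranclp_induct)
  case (step x y)
  from step(2) have "exchange (u @ x @ v) (u @ y @ v)"
  proof cases
    case (1 i j u' s t v')
    then show ?thesis using exchange.intros[of i j "u @ u'" s t "v' @ v"] by simp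
  qed
  then show ?case using step(3) by simp
qed simp

lemma exchange_unmarked: "w \<simeq> w' \<Longrightarrow> unmarked (map fst w) \<simeq> unmarked (map fst w')"
proof (induction rule: rtranclp_induct)
  case (step x y)
  from step(2) have "exchange (unmarked (map fst x)) (unmarked (map fst y))"
  proof cases
    case (1 i j u' s t v')
    then show ?thesis
      using exchange.intros[of i j "unmarked (map fst u')" False False "unmarked (map fst v')"]
      by (simp add: unmarked_def)
  qed
  then show ?case using step(3) by simp
qed simp

lemma exchange_filter:
  "w \<simeq> w' \<Longrightarrow> filter (\<lambda>x. at_bonds i (fst x)) w = filter (\<lambda>x. at_bonds i (fst x)) w'"
proof (induction rule: rtranclp_induct)
  case (step x y)
  from step(2) have "filter (\<lambda>x. at_bonds i (fst x)) x = filter (\<lambda>x. at_bonds i (fst x)) y"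
    by cases (auto simp: at_bonds_def)
  then show ?case using step by simp
qed simp

lemma exchange_set: "w \<simeq> w' \<Longrightarrow> set w = set w'"
proof (induction rule: rtranclp_induct)
  case (step x y)
  from step(2) have "set x = set y" by cases auto
  then show ?case using step by simp
qed simp

definition far :: "marked_word \<Rightarrow> marked_word \<Rightarrow> bool" where
  "far xs ys \<longleftrightarrow> (\<forall>x\<in>set xs. \<forall>y\<in>set ys. fst x + 2 \<le> fst y \<or> fst y + 2 \<le> fst x)"

lemma exchange_past: "far [x] ys \<Longrightarrow> x # ys \<simeq> ys @ [x]"
proof (induction ys)
  case (Cons y ys)
  obtain i s j t where xy: "x = (i, s)" "y = (j, t)" by fastforce
  have "exchange ([] @ [x, y] @ ys) ([] @ [y, x] @ ys)"
    unfolding xy by (rule exchange.intros) (use Cons.prems xy in \<open>auto simp: far_def\<close>)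
  moreover have "[y] @ (x # ys) @ [] \<simeq> [y] @ (ys @ [x]) @ []"
    by (rule exchange_context) (use Cons in \<open>auto simp: far_def\<close>)
  ultimately show ?case by (simp add: converse_rtranclp_into_rtranclp)
qed simp

lemma exchange_blocks: "far xs ys \<Longrightarrow> xs @ ys \<simeq> ys @ xs"
proof (induction xs)
  case (Cons x xs)
  have "[x] @ (xs @ ys) @ [] \<simeq> [x] @ (ys @ xs) @ []"
    by (rule exchange_context) (use Cons in \<open>auto simp: far_def\<close>)
  moreover have "[] @ (x # ys) @ xs \<simeq> [] @ (ys @ [x]) @ xs"
    by (rule exchange_context, rule exchange_past) (use Cons.prems in \<open>auto simp: far_def\<close>)
  ultimately show ?case by simp
qed simp

lemma exchange_swap:
  assumes "w \<simeq> u @ xs @ ys @ v" "far xs ys"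
  shows "w \<simeq> u @ ys @ xs @ v"
  using exchange_context[OF exchange_blocks[OF assms(2)], of u v] assms(1) by simp

lemma unmarked_append [simp]: "unmarked (u @ v) = unmarked u @ unmarked v"
  by (simp add: unmarked_def)

lemma unmarked_Cons [simp]: "unmarked (j # v) = (j, False) # unmarked v"
  by (simp add: unmarked_def)

lemma unmarked_Nil [simp]: "unmarked [] = []"
  by (simp add: unmarked_def)

lemma set_unmarked [simp]: "set (unmarked u) = (\<lambda>j. (j, False)) ` set u"
  by (simp add: unmarked_def)

text \<open>Gates on the same or on neighbouring bonds never exchange, so the subword on two
  neighbouring bonds is an invariant. This is what excludes steps of the algorithm.\<close>

lemma marked_decomp:
  assumes "w \<simeq> unmarked u @ (a, True) # unmarked v" "w \<simeq> u' @ (b, True) # v'"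
  shows "b = a"
    and "at_bonds i a \<Longrightarrow> filter (at_bonds i) (map fst u') = filter (at_bonds i) u"
    and "at_bonds i a \<Longrightarrow> filter (at_bonds i) (map fst v') = filter (at_bonds i) v"
    and "filter (at_bonds i) (map fst (u' @ (b, True) # v')) = filter (at_bonds i) (u @ a # v)"
proof -
  let ?f = "filter (\<lambda>x. at_bonds i (fst x))"
  have e: "u' @ (b, True) # v' \<simeq> unmarked u @ (a, True) # unmarked v"
    using exchange_sym[OF assms(2)] assms(1) by simp
  then show b: "b = a"
    using exchange_set[OF e] by auto
  have mf: "map fst (?f x) = filter (at_bonds i) (map fst x)" for x :: marked_word
    by (simp add: filter_map comp_def)
  have "map fst (?f (u' @ (b, True) # v')) = map fst (?f (unmarked u @ (a, True) # unmarked v))"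
    by (simp only: exchange_filter[OF e])
  then show "filter (at_bonds i) (map fst (u' @ (b, True) # v')) = filter (at_bonds i) (u @ a # v)"
    unfolding mf by simp
  have "?f u' = ?f (unmarked u) \<and> ?f v' = ?f (unmarked v)" if "at_bonds i a"
  proof -
    \<comment> \<open>The marked gate does not occur among the unmarked ones, so this equation
      splits at it.\<close>
    have "?f (unmarked u) @ (a, True) # ?f (unmarked v) = ?f u' @ (a, True) # ?f v'"
      using exchange_filter[OF e, of i] that b by simp
    then show ?thesis
      by (subst (asm) append_Cons_eq_iff) auto
  qed
  then have "map fst (?f u') = map fst (?f (unmarked u))" "map fst (?f v') = map fst (?f (unmarked v))"
    if "at_bonds i a" using that by simp_all
  then show "filter (at_bonds i) (map fst u') = filter (at_bonds i) u"
    "filter (at_bonds i) (map fst v') = filter (at_bonds i) v" if "at_bonds i a"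
    using that unfolding mf by simp_all
qed

text \<open>Two gates that merge are adjacent in both windows containing bond \<open>a\<close>,
  namely \<open>a - 1\<close> and \<open>a\<close>. One window excluding a partner on the left and
  one excluding a partner on the right therefore suffice.\<close>

lemma no_merge:
  assumes w: "w \<simeq> unmarked u @ (a, True) # unmarked v"
    and i: "at_bonds i a" "\<nexists>x. filter (at_bonds i) u = x @ [a]"
    and j: "at_bonds j a" "\<nexists>x. filter (at_bonds j) v = a # x"
  shows "\<nexists>x. merge w x"
proof
  assume "\<exists>x. merge w x"
  then obtain x where "merge w x" ..
  then show False
  proof cases
    case (1 u' b v')
    then have "w \<simeq> u' @ (b, True) # ((b, False) # v')" by simp
    from marked_decomp(1)[OF w this] marked_decomp(3)[OF w this j(1)] j show False
      by (metis filter.simps(2) fst_conv list.simps(9))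
  next
    case (2 u' b v')
    then have "w \<simeq> (u' @ [(b, False)]) @ (b, True) # v'" by simp
    have "filter (at_bonds i) u = filter (at_bonds i) (map fst u') @ [a]"
      using marked_decomp(1)[OF w \<open>w \<simeq> (u' @ [(b, False)]) @ _\<close>]
        marked_decomp(2)[OF w \<open>w \<simeq> (u' @ [(b, False)]) @ _\<close> i(1)] i(1) by simp
    then show False using i(2) by auto
  qed
qed

lemma no_move1:
  assumes w: "w \<simeq> unmarked u @ (a, True) # unmarked v"
    and "(\<nexists>x. filter (at_bonds a) v = Suc a # a # x) \<or> 1 \<le> a \<and> (\<nexists>x. filter (at_bonds (a - 1)) v = a # x)"
  shows "\<nexists>x. move1 w x"
proof
  assume "\<exists>x. move1 w x"
  then obtain x where "move1 w x" ..
  then show False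
  proof cases
    case (1 u' i v')
    then have e: "w \<simeq> u' @ (i - 1, True) # ((i, False) # (i - 1, False) # v')" by simp
    have a: "i = Suc a" using marked_decomp(1)[OF w e] 1 by simp
    have "filter (at_bonds a) v = Suc a # a # filter (at_bonds a) (map fst v')"
      using marked_decomp(3)[OF w e, of a] by (simp add: at_bonds_def a)
    moreover have "filter (at_bonds (a - 1)) v = a # filter (at_bonds (a - 1)) (map fst v')" if "1 \<le> a"
      using marked_decomp(3)[OF w e, of "a - 1"] that by (cases a) (simp_all add: at_bonds_def a)
    ultimately show False using assms(2) by auto
  qed
qed

text \<open>Freshness allows nothing behind the gate to be passed in window \<open>a\<close>, and
  nothing at all in window \<open>a - 1\<close>. The guard \<open>1 \<le> a\<close> is due to
  truncated subtraction.\<close>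

lemma no_move2:
  assumes w: "w \<simeq> unmarked u @ (a, True) # unmarked v"
    and "filter (at_bonds a) v \<noteq> [Suc a] \<or> 1 \<le> a \<and> filter (at_bonds (a - 1)) v \<noteq> []"
  shows "\<nexists>x. move2 w x"
proof
  assume "\<exists>x. move2 w x"
  then obtain x where "move2 w x" ..
  then show False
  proof cases
    case (1 u' i v')
    then have e: "w \<simeq> u' @ (i - 1, True) # ((i, False) # v')" by simp
    have a: "i = Suc a" using marked_decomp(1)[OF w e] 1 by simp
    have f: "j \<notin> set (map fst v')" if "j \<in> {a - 1, a, Suc a}" for j
      using 1(4) that a unfolding fresh_below_def by auto
    have v': "filter (at_bonds a) (map fst v') = []" "1 \<le> a \<Longrightarrow> filter (at_bonds (a - 1)) (map fst v') = []"
      unfolding filter_empty_conv at_bonds_def using f by auto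
    have "filter (at_bonds a) v = [Suc a]"
      using marked_decomp(3)[OF w e, of a] v' by (simp add: at_bonds_def a)
    moreover have "filter (at_bonds (a - 1)) v = []" if "1 \<le> a"
      using marked_decomp(3)[OF w e, of "a - 1"] v' that by (cases a) (simp_all add: at_bonds_def a)
    ultimately show False using assms(2) by auto
  qed
qed

text \<open>Window \<open>a - 2\<close> does not contain bond \<open>a\<close> and cannot tell the
  two sides of the marked gate apart; its condition therefore concerns \<open>u @ v\<close>.\<close>

lemma no_move3:
  assumes w: "w \<simeq> unmarked u @ (a, True) # unmarked v"
    and "filter (at_bonds (a - 1)) v \<noteq> [] \<or> (\<nexists>x. filter (at_bonds (a - 2)) (u @ v) = x @ [a - 1])"
  shows "\<nexists>x. move3 w x"
proof
  assume "\<exists>x. move3 w x"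
  then obtain x where "move3 w x" ..
  then show False
  proof cases
    case (1 u' i v')
    then have e: "w \<simeq> (u' @ [(i - 1, False)]) @ (i, True) # v'" by simp
    have a: "i = a" "2 \<le> a" using marked_decomp(1)[OF w e] 1 by auto
    have f: "j \<notin> set (map fst v')" if "j \<in> {a - 2, a - 1, a}" for j
      using 1(4) that a unfolding fresh_below_def by auto
    obtain b where b: "a = Suc (Suc b)" using a(2) by (metis add_2_eq_Suc le_Suc_ex)
    have v': "filter (at_bonds (a - 1)) (map fst v') = []" "filter (at_bonds (a - 2)) (map fst v') = []"
      unfolding filter_empty_conv at_bonds_def using f b by auto
    have "filter (at_bonds (a - 1)) v = []"
      using marked_decomp(3)[OF w e, of "a - 1"] v' b by (simp add: at_bonds_def a)
    moreover have "filter (at_bonds (a - 2)) (u @ v) = filter (at_bonds (a - 2)) (map fst u') @ [a - 1]"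
      using marked_decomp(4)[OF w e, of "a - 2"] v' b by (simp add: at_bonds_def a)
    ultimately show False using assms(2) by auto
  qed
qed

lemma no_move4:
  assumes w: "w \<simeq> unmarked u @ (a, True) # unmarked v"
    and "1 \<le> a" "\<nexists>x. filter (at_bonds (a - 1)) u = x @ [a]"
  shows "\<nexists>x. move4 w x"
proof
  assume "\<exists>x. move4 w x"
  then obtain x where "move4 w x" ..
  then show False
  proof cases
    case (1 u' i v')
    then have e: "w \<simeq> (u' @ [(i - 1, False), (i, False)]) @ (i - 1, True) # v'" by simp
    have a: "i = Suc a" using marked_decomp(1)[OF w e] 1 by simp
    obtain b where b: "a = Suc b" using assms(2) by (cases a) auto
    have "filter (at_bonds (a - 1)) u = filter (at_bonds (a - 1)) (map fst u') @ [a]"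
      using marked_decomp(2)[OF w e, of "a - 1"] by (simp add: at_bonds_def a b)
    then show False using assms(3) by auto
  qed
qed

lemma filter_rev_upt:
  "filter (at_bonds i) (rev [k..<m]) =
     (if k \<le> Suc i \<and> Suc i < m then [Suc i] else []) @ (if k \<le> i \<and> i < m then [i] else [])"
proof (induction m)
  case (Suc m)
  then show ?case by (auto simp: at_bonds_def)
qed simp

text \<open>A sequence that starts below \<open>a\<close> and reaches \<open>a\<close> also has a
  gate on \<open>a - 1\<close>, which acts earlier and so stands further right.\<close>

lemma filter_rsf_word_last:
  "\<forall>(k, l)\<in>set e. k < a \<Longrightarrow> \<nexists>x. filter (at_bonds (a - 1)) (rsf_word e) = x @ [a]"
proof (induction e rule: rev_induct)
  case (snoc y e)
  obtain k l where y: "y = (k, l)" by fastforce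
  have "k < a" using snoc.prems y by simp
  then have "filter (at_bonds (a - 1)) (rev [k..<k + l]) = [] \<or>
      (\<exists>x. filter (at_bonds (a - 1)) (rev [k..<k + l]) = x @ [a - 1])"
    unfolding filter_rev_upt by auto
  then show ?case
    using snoc y \<open>k < a\<close> by (auto simp: filter_append)
qed simp

lemma filter_at_bonds_ge: "\<forall>x\<in>set v. i + 2 \<le> x \<Longrightarrow> filter (at_bonds i) v = []"
  by (auto simp: filter_empty_conv at_bonds_def)

text \<open>Covers the cases in which the new gate stays where it is: it extends a sequence with top
  bond \<open>q - 1\<close>, or it starts a sequence of its own.\<close>

lemma run_stuck:
  assumes w: "w \<simeq> unmarked (rsf_word e) @ (q, True) # unmarked v"
    and q: "1 \<le> q" and e: "\<forall>(k, l)\<in>set e. k + 2 \<le> q"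
    and v: "(\<exists>x. filter (at_bonds (q - 1)) v = (q - 1) # x) \<or> (\<forall>x\<in>set v. q + 2 \<le> x)"
  shows "run 1 w w"
proof -
  have L: "\<nexists>x. filter (at_bonds (q - 1)) (rsf_word e) = x @ [q]"
    by (rule filter_rsf_word_last) (use e in fastforce)
  have L2: "\<nexists>x. filter (at_bonds (q - 2)) (rsf_word e) = x @ [q - 1]"
    using filter_rsf_word_last[of e "q - 1"] e q by (fastforce simp: numeral_2_eq_2)
  have ne: "q - 1 \<noteq> q" using q by simp
  have v': "filter (at_bonds i) v = []" if "\<forall>x\<in>set v. q + 2 \<le> x" "i \<le> q" for i
    by (rule filter_at_bonds_ge) (use that in fastforce)
  have "\<nexists>x. merge w x"
  proof (rule no_merge[OF w _ L])
    show "\<nexists>x. filter (at_bonds (q - 1)) v = q # x"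
      using v v'[of "q - 1"] ne by auto
  qed (use q in \<open>auto simp: at_bonds_def\<close>)
  moreover have "\<nexists>x. move1 w x"
    by (rule no_move1[OF w]) (use v v'[of "q - 1"] q ne in auto)
  moreover have "\<nexists>x. move2 w x"
    by (rule no_move2[OF w]) (use v v'[of "q"] q in auto)
  moreover have "\<nexists>x. move3 w x"
    by (rule no_move3[OF w]) (use v v'[of "q - 2"] L2 in auto)
  moreover have "\<nexists>x. move4 w x"
    by (rule no_move4[OF w q L])
  ultimately show ?thesis
    by (intro run.skip1 run.skip2 run.skip3 run.stop4)
qed

lemma rev_upt_split: "k \<le> m \<Longrightarrow> m \<le> n \<Longrightarrow> rev [k..<n] = rev [m..<n] @ rev [k..<m]"
  by (metis le_Suc_ex rev_append upt_add_eq_append)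

lemma rev_upt_snoc: "m < n \<Longrightarrow> rev [m..<n] = rev [Suc m..<n] @ [m]"
  by (simp add: upt_conv_Cons)

lemma run_merge:
  assumes "1 \<le> n" "n \<le> 4" "merge w w'" 
  shows "run n w w'"
  by (rule run.merge) (use assms in auto)

lemma run_exI:
  "run n w x \<Longrightarrow> map fst x = z \<Longrightarrow> \<exists>x. run n w x \<and> unmarked (map fst x) \<simeq> unmarked z"
  by auto

text \<open>The loop of step 4: the marked gate, at bond \<open>a\<close>, has already split two neighbouring sequences
  of gates below \<open>a\<close>; it continues until one of the two upper parts is exhausted.\<close>

lemma run_step4_loop:
  assumes "w \<simeq> unmarked (rsf_word e) @ unmarked (rev [a..<k + l]) @ unmarked (rev [a + 1..<k + 2 + l'])
      @ (a, True) # unmarked (rev [k..<a] @ rev [k + 2..<a + 1] @ v)"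
    and "k < a" "a \<le> k + l" "a + 1 \<le> k + 2 + l'" "\<forall>(k', l')\<in>set e. k' < k"
  shows "\<exists>x. run 4 w x \<and> unmarked (map fst x) \<simeq> unmarked (rsf_word e @
      (if l \<le> l' + 1 then rev [k..<k + l' + 2] @ rev [k + 2..<k + 1 + l]
       else rev [k..<k + l] @ rev [k + 2..<k + 2 + l']) @ v)"
  using assms
proof (induction "k + l - a" arbitrary: a w rule: less_induct)
  case less
  let ?u = "unmarked (rsf_word e)"
  have a: "1 \<le> a" using less.prems by simp
  have right: "\<nexists>x. filter (at_bonds (a - 1)) (rev [k..<a] @ rev [k + 2..<a + 1] @ v) = a # x"
    using less.prems(2) by (auto simp: filter_rev_upt)
  consider "a < k + l" "a + 1 < k + 2 + l'" | "a < k + l" "a + 1 = k + 2 + l'" | "a = k + l"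
    using less.prems by linarith
  then show ?case
  proof cases
    case 1
    have w: "w \<simeq> unmarked (rsf_word e @ rev [a..<k + l] @ rev [a + 1..<k + 2 + l']) @
        (a, True) # unmarked (rev [k..<a] @ rev [k + 2..<a + 1] @ v)"
      using less.prems(1) by simp
    have "filter (at_bonds a) (rsf_word e @ rev [a..<k + l] @ rev [a + 1..<k + 2 + l']) =
      filter (at_bonds a) (rsf_word e @ rev [a..<k + l]) @ [Suc a]"
      unfolding filter_append filter_rev_upt using 1 by auto
    then have nm: "\<nexists>x. merge w x"
      by (intro no_merge[OF w, of a "a - 1"] right) (use a in \<open>auto simp: at_bonds_def\<close>)
    have "w \<simeq> (?u @ unmarked (rev [Suc a..<k + l])) @ [(a, False)] @ unmarked (rev [Suc (Suc a)..<k + 2 + l'])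
      @ ((Suc a, False) # (a, True) # unmarked (rev [k..<a] @ rev [k + 2..<a + 1] @ v))"
      using less.prems(1) rev_upt_snoc[OF 1(1)] rev_upt_snoc[OF 1(2)] by simp
    then have "w \<simeq> (?u @ unmarked (rev [Suc a..<k + l])) @ unmarked (rev [Suc (Suc a)..<k + 2 + l'])
      @ [(a, False)] @ ((Suc a, False) # (a, True) # unmarked (rev [k..<a] @ rev [k + 2..<a + 1] @ v))"
      by (rule exchange_swap) (auto simp: far_def)
    then have "w \<simeq> (?u @ unmarked (rev [Suc a..<k + l] @ rev [Suc (Suc a)..<k + 2 + l']))
      @ [(Suc a - 1, False), (Suc a, False), (Suc a - 1, True)]
      @ unmarked (rev [k..<a] @ rev [k + 2..<a + 1] @ v)"
      by simp
    then have m: "move4 w ((?u @ unmarked (rev [Suc a..<k + l] @ rev [Suc (Suc a)..<k + 2 + l']))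
      @ [(Suc a, True), (Suc a - 1, False), (Suc a, False)]
      @ unmarked (rev [k..<a] @ rev [k + 2..<a + 1] @ v))" (is "move4 w ?w1")
      by (rule move4.intros) (use a in simp)
    have "?w1 \<simeq> (?u @ unmarked (rev [Suc a..<k + l] @ rev [Suc (Suc a)..<k + 2 + l']) @ [(Suc a, True), (a, False)])
      @ [(Suc a, False)] @ unmarked (rev [k..<a]) @ unmarked (rev [k + 2..<a + 1] @ v)"
      by simp
    then have "?w1 \<simeq> (?u @ unmarked (rev [Suc a..<k + l] @ rev [Suc (Suc a)..<k + 2 + l']) @ [(Suc a, True), (a, False)])
      @ unmarked (rev [k..<a]) @ [(Suc a, False)] @ unmarked (rev [k + 2..<a + 1] @ v)"
      by (rule exchange_swap) (auto simp: far_def)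
    then have "?w1 \<simeq> ?u @ unmarked (rev [a + 1..<k + l]) @ unmarked (rev [a + 1 + 1..<k + 2 + l'])
      @ (a + 1, True) # unmarked (rev [k..<a + 1] @ rev [k + 2..<a + 1 + 1] @ v)"
      using less.prems(2) by simp
    then have "\<exists>x. run 4 ?w1 x \<and> unmarked (map fst x) \<simeq> unmarked (rsf_word e @
      (if l \<le> l' + 1 then rev [k..<k + l' + 2] @ rev [k + 2..<k + 1 + l]
       else rev [k..<k + l] @ rev [k + 2..<k + 2 + l']) @ v)"
      by (rule less.hyps[rotated]) (use less.prems(2-5) 1 in auto)
    then show ?thesis using run.step4[OF nm m] by blast
  next
    \<comment> \<open>The upper part of the second sequence is used up, so the marked gate meets the
      gate of the first one on bond \<open>a\<close> and merges. This is the case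
      \<open>l > l' + 1\<close>; both sequences end as they began.\<close>
    case 2
    have "w \<simeq> (?u @ unmarked (rev [Suc a..<k + l])) @ [(a, False), (a, True)] @
      unmarked (rev [k..<a] @ rev [k + 2..<a + 1] @ v)"
      using less.prems(1) rev_upt_snoc[OF 2(1)] 2(2) by (simp del: upt_Suc)
    from merge.intros(2)[OF this]
    have "run 4 w ((?u @ unmarked (rev [Suc a..<k + l])) @ [(a, False)] @
      unmarked (rev [k..<a] @ rev [k + 2..<a + 1] @ v))" (is "run 4 w ?x")
      by (intro run_merge) auto
    moreover have "map fst ?x = rsf_word e @ (if l \<le> l' + 1 then rev [k..<k + l' + 2] @ rev [k + 2..<k + 1 + l]
       else rev [k..<k + l] @ rev [k + 2..<k + 2 + l']) @ v"
      using rev_upt_split[of k a "k + l"] rev_upt_snoc[OF 2(1)] less.prems(2) 2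
      by (simp del: upt_Suc)
    ultimately show ?thesis by (rule run_exI)
  next
    \<comment> \<open>The upper part of the first sequence is used up. The marked gate stays on bond
      \<open>a = k + l\<close> and links the upper part of the second sequence to the lower part of
      the first, so the end points are exchanged.\<close>
    case 3
    have w: "w \<simeq> unmarked (rsf_word e @ rev [a + 1..<k + 2 + l']) @
        (a, True) # unmarked (rev [k..<a] @ rev [k + 2..<a + 1] @ v)"
      using less.prems(1) 3 by simp
    have "\<nexists>x. filter (at_bonds (a - 1)) (rsf_word e) = x @ [a]"
      by (rule filter_rsf_word_last) (use less.prems in fastforce)
    then have left: "\<nexists>x. filter (at_bonds (a - 1)) (rsf_word e @ rev [a + 1..<k + 2 + l']) = x @ [a]"
      using a by (simp add: filter_rev_upt)
    have "\<nexists>x. merge w x"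
      by (rule no_merge[OF w _ left _ right]) (use a in \<open>auto simp: at_bonds_def\<close>)
    then have "run 4 w w"
      by (rule run.stop4) (rule no_move4[OF w a left])
    moreover have "rev [k..<k + l' + 2] = rev [a + 1..<k + l' + 2] @ a # rev [k..<a]"
      using rev_upt_split[of k "a + 1" "k + l' + 2"] less.prems by simp
    then have "unmarked (map fst w) \<simeq> unmarked (rsf_word e @ rev [k..<k + l' + 2] @ rev [k + 2..<k + 1 + l] @ v)"
      using exchange_unmarked[OF w] 3 by (simp add: add_ac)
    moreover have "l \<le> l' + 1" using less.prems 3 by simp
    ultimately show ?thesis by auto
  qed
qed

text \<open>The marked gate has already passed the sequences of \<open>e\<close>. Since these start below bond \<open>q - 1\<close>, the
  last gate of \<open>e\<close> on the bonds \<open>q - 1\<close> and \<open>q\<close> is on bond \<open>q - 1\<close>, so \<open>e\<close> takes no further part.\<close>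

lemma run_act:
  assumes "layout_from c L d" "\<forall>(k, l)\<in>set e. k + 2 \<le> q" "1 \<le> q"
    "w \<simeq> unmarked (rsf_word e) @ (q, True) # unmarked (rsf_word d)"
  shows "\<exists>x. run 1 w x \<and> unmarked (map fst x) \<simeq> unmarked (rsf_word (e @ act q d))"
  using assms
proof (induction q d arbitrary: c e w rule: act.induct)
  case (1 q)
  then have "run 1 w w" by (intro run_stuck[of w e q "[]"]) auto
  then show ?case using exchange_unmarked[OF 1(4)] by auto
next
  case (2 q k l d)
  let ?u = "unmarked (rsf_word e)" and ?v = "unmarked (rsf_word d)"
  have w: "w \<simeq> unmarked (rsf_word e) @ (q, True) # unmarked (rsf_word ((k, l) # d))"
    using 2 by blast
  have e: "\<forall>(k, l)\<in>set e. k + 2 \<le> q" and q: "1 \<le> q" and l: "1 \<le> l" and d: "layout_from (k + 2) L d"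
    using 2 by auto
  have d': "\<forall>x\<in>set (rsf_word d). k + 2 \<le> x" by (rule rsf_word_ge[OF d])
  have kl: "rev [k..<k + l] = rev [Suc k..<k + l] @ [k]" using l by (intro rev_upt_snoc) simp
  have L: "\<nexists>x. filter (at_bonds (q - 1)) (rsf_word e) = x @ [q]"
    by (rule filter_rsf_word_last) (use e in fastforce)
  have fq: "filter (at_bonds i) (rsf_word d) = []" if "i \<le> k" for i
    by (rule filter_at_bonds_ge) (use d' that in fastforce)
  consider "q + 2 \<le> k" | "q + 1 = k" | "q = k + l" | "q + 1 = k + l" "q \<ge> k" | "k + l < q"
    | "k < q" "q + 1 < k + l" | "q = k" "q + 1 < k + l"
    by linarith
  then show ?case
  proof cases
    case 1
    then have "run 1 w w"
      by (intro run_stuck[OF w q e]) (use d' in fastforce)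
    then show ?thesis using exchange_unmarked[OF w] 1 by auto
  next
    \<comment> \<open>Step 2 takes the gate past the lowest gate of the sequence, which it thereby
      extends at the bottom.\<close>
    case 2
    have w': "w \<simeq> unmarked (rsf_word e) @ (q, True) # unmarked (rev [k..<k + l] @ rsf_word d)"
      using w by simp
    have nm: "\<nexists>x. merge w x"
      by (rule no_merge[OF w' _ L, where j = q]) (use q 2 l in \<open>auto simp: at_bonds_def filter_rev_upt\<close>)
    have nm1: "\<nexists>x. move1 w x"
      by (rule no_move1[OF w']) (use q 2 l fq[of q] in \<open>auto simp: filter_rev_upt\<close>)
    have "w \<simeq> ?u @ [(q, True)] @ unmarked (rev [Suc k..<k + l]) @ ((k, False) # ?v)"
      using w kl by simp
    then have "w \<simeq> ?u @ unmarked (rev [Suc k..<k + l]) @ [(q, True)] @ ((k, False) # ?v)"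
      by (rule exchange_swap) (use 2 in \<open>auto simp: far_def\<close>)
    then have "w \<simeq> (?u @ unmarked (rev [Suc k..<k + l])) @ [(k - 1, True), (k, False)] @ ?v"
      using 2 by auto
    then have m: "move2 w ((?u @ unmarked (rev [Suc k..<k + l])) @ [(k, False), (k - 1, True)] @ ?v)"
      (is "move2 w ?w1")
      by (rule move2.intros) (use 2 q d' in \<open>fastforce simp: fresh_below_def\<close>)+
    have w1: "?w1 \<simeq> unmarked (rsf_word e @ rev [k..<k + l]) @ (q, True) # ?v"
      using kl 2 by auto
    have fl: "filter (at_bonds i) (rev [k..<k + l]) = []" if "i < q" for i
      using that 2 by (auto simp: filter_rev_upt)
    have L1: "\<nexists>x. filter (at_bonds (q - 1)) (rsf_word e @ rev [k..<k + l]) = x @ [q]"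
      using L fl[of "q - 1"] q by simp
    have L2: "\<nexists>x. filter (at_bonds (q - 2)) (rsf_word e) = x @ [q - 1]"
      using filter_rsf_word_last[of e "q - 1"] e q by (fastforce simp: numeral_2_eq_2)
    have nm': "\<nexists>x. merge ?w1 x"
      by (rule no_merge[OF w1 _ L1, where j = "q - 1"]) (use q 2 fq[of "q - 1"] in \<open>auto simp: at_bonds_def\<close>)
    have nm3: "\<nexists>x. move3 ?w1 x"
      by (rule no_move3[OF w1]) (use L2 q 2 fq[of "q - 2"] fl[of "q - 2"] in auto)
    have nm4: "\<nexists>x. move4 ?w1 x"
      by (rule no_move4[OF w1 q L1])
    have "run 1 w ?w1"
      by (rule run.skip1[OF nm nm1 run.step2[OF nm m run.skip3[OF nm' nm3 run.stop4[OF nm' nm4]]]])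
    moreover have "rev [q..<k + l] = rev [k..<k + l] @ [q]"
      using rev_upt_snoc[of q "k + l"] 2 by simp
    then have "map fst ?w1 = rsf_word (e @ act q ((k, l) # d))"
      using 2 kl by (auto simp: add_ac)
    ultimately show ?thesis by (rule run_exI)
  next
    case 3
    then have "run 1 w w"
      by (intro run_stuck[OF w q e]) (use l in \<open>auto simp: filter_rev_upt\<close>)
    moreover have "rev [k..<Suc (k + l)] = q # rev [k..<k + l]" using 3 by simp
    ultimately show ?thesis using exchange_unmarked[OF w] 3 l by auto
  next
    case 4
    have "k + l = Suc q" using 4 by simp
    then have s: "rev [k..<k + l] = q # rev [k..<q]" using 4(2) by (simp only: upt_Suc_append rev_append) simp
    then have "w \<simeq> ?u @ [(q, True), (q, False)] @ (unmarked (rev [k..<q]) @ ?v)"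
      using w by simp
    from merge.intros(1)[OF this]
    have "run 1 w (?u @ [(q, False)] @ (unmarked (rev [k..<q]) @ ?v))" (is "run 1 w ?x")
      by (intro run_merge) auto
    moreover have "map fst ?x = rsf_word (e @ act q ((k, l) # d))"
      using 4 s by simp
    ultimately show ?thesis by (rule run_exI)
  next
    case 5
    have "w \<simeq> ?u @ [(q, True)] @ unmarked (rev [k..<k + l]) @ ?v"
      using w by simp
    then have "w \<simeq> ?u @ unmarked (rev [k..<k + l]) @ [(q, True)] @ ?v"
      by (rule exchange_swap) (use 5 in \<open>auto simp: far_def\<close>)
    then have "w \<simeq> unmarked (rsf_word (e @ [(k, l)])) @ (q, True) # ?v"
      by simp
    moreover have "\<forall>(k, l)\<in>set (e @ [(k, l)]). k + 2 \<le> q" using e 5 l by auto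
    ultimately obtain x where "run 1 w x" "unmarked (map fst x) \<simeq> unmarked (rsf_word ((e @ [(k, l)]) @ act q d))"
      using "2.IH"(1)[of "k + 2" "e @ [(k, l)]" w] 5 q d l by auto
    then show ?thesis using 5 by auto
  next
    \<comment> \<open>Step 1 carries the gate through the sequence. It comes out on bond
      \<open>q + 1\<close>, in accordance with the shifted labels of the later sequences.\<close>
    case 6
    have s: "rev [k..<k + l] = rev [q + 2..<k + l] @ [q + 1, q] @ rev [k..<q]"
      using rev_upt_split[of k q "k + l"] rev_upt_snoc[of q "k + l"] rev_upt_snoc[of "Suc q" "k + l"] 6
      by simp
    have w': "w \<simeq> unmarked (rsf_word e) @ (q, True) # unmarked (rev [k..<k + l] @ rsf_word d)"
      using w by simp
    have nm: "\<nexists>x. merge w x"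
      by (rule no_merge[OF w' _ L, where j = q]) (use q 6 in \<open>auto simp: at_bonds_def filter_rev_upt\<close>)
    have "w \<simeq> ?u @ [(q, True)] @ unmarked (rev [q + 2..<k + l]) @ unmarked ([q + 1, q] @ rev [k..<q] @ rsf_word d)"
      using w s by simp
    then have "w \<simeq> ?u @ unmarked (rev [q + 2..<k + l]) @ [(q, True)] @ unmarked ([q + 1, q] @ rev [k..<q] @ rsf_word d)"
      by (rule exchange_swap) (use 6 in \<open>auto simp: far_def\<close>)
    then have "w \<simeq> (?u @ unmarked (rev [q + 2..<k + l])) @ [(Suc q - 1, True), (Suc q, False), (Suc q - 1, False)]
        @ unmarked (rev [k..<q] @ rsf_word d)"
      by simp
    then have m: "move1 w ((?u @ unmarked (rev [q + 2..<k + l])) @ [(Suc q, False), (Suc q - 1, False), (Suc q, True)]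
        @ unmarked (rev [k..<q] @ rsf_word d))" (is "move1 w ?w1")
      by (rule move1.intros) (use q in simp)
    have "?w1 \<simeq> (?u @ unmarked (rev [q + 2..<k + l]) @ [(Suc q, False), (q, False)]) @ [(Suc q, True)]
        @ unmarked (rev [k..<q]) @ ?v"
      by simp
    then have "?w1 \<simeq> (?u @ unmarked (rev [q + 2..<k + l]) @ [(Suc q, False), (q, False)])
        @ unmarked (rev [k..<q]) @ [(Suc q, True)] @ ?v"
      by (rule exchange_swap) (use 6 in \<open>auto simp: far_def\<close>)
    then have "?w1 \<simeq> unmarked (rsf_word (e @ [(k, l)])) @ (q + 1, True) # ?v"
      using s by simp
    moreover have "\<forall>(k, l)\<in>set (e @ [(k, l)]). k + 2 \<le> q + 1" using e 6 by auto
    ultimately obtain x where "run 1 ?w1 x"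
      "unmarked (map fst x) \<simeq> unmarked (rsf_word ((e @ [(k, l)]) @ act (q + 1) d))"
      using "2.IH"(2)[of "k + 2" "e @ [(k, l)]" ?w1] 6 q d l by auto
    then show ?thesis using run.step1[OF nm m] 6 by auto
  next
    \<comment> \<open>The gate comes out of the sequence on bond \<open>k + 1\<close>. If the next
      sequence starts at \<open>k + 2\<close>, step 2 passes the lowest gate of that sequence, step
      3 the lowest gate of the first one, and the loop of step 4 begins with
      \<open>a = k + 1\<close>.\<close>
    case 7
    have s: "rev [k..<k + l] = rev [k + 2..<k + l] @ [k + 1, k]"
      using rev_upt_snoc[of k "k + l"] rev_upt_snoc[of "Suc k" "k + l"] 7 by simp
    have w': "w \<simeq> unmarked (rsf_word e) @ (q, True) # unmarked (rev [k..<k + l] @ rsf_word d)"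
      using w by simp
    have nm: "\<nexists>x. merge w x"
      by (rule no_merge[OF w' _ L, where j = q]) (use q 7 in \<open>auto simp: at_bonds_def filter_rev_upt\<close>)
    have "w \<simeq> ?u @ [(k, True)] @ unmarked (rev [k + 2..<k + l]) @ unmarked ([k + 1, k] @ rsf_word d)"
      using w s 7 by simp
    then have "w \<simeq> ?u @ unmarked (rev [k + 2..<k + l]) @ [(k, True)] @ unmarked ([k + 1, k] @ rsf_word d)"
      by (rule exchange_swap) (auto simp: far_def)
    then have "w \<simeq> (?u @ unmarked (rev [k + 2..<k + l])) @ [(Suc k - 1, True), (Suc k, False), (Suc k - 1, False)] @ ?v"
      by simp
    then have m: "move1 w ((?u @ unmarked (rev [k + 2..<k + l])) @ [(Suc k, False), (Suc k - 1, False), (Suc k, True)] @ ?v)"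
      (is "move1 w ?w1")
      by (rule move1.intros) (use q 7 in simp)
    have w1: "?w1 \<simeq> unmarked (rsf_word e @ rev [k..<k + l]) @ (k + 1, True) # unmarked (rsf_word d)"
      using s by simp
    have left: "\<nexists>x. filter (at_bonds k) (rsf_word e @ rev [k..<k + l]) = x @ [k + 1]"
      using 7 by (simp add: filter_rev_upt)
    have nm1: "\<nexists>x. merge ?w1 x"
      by (rule no_merge[OF w1 _ left, where j = k]) (use fq[of k] in \<open>auto simp: at_bonds_def\<close>)
    have nm11: "\<nexists>x. move1 ?w1 x"
      by (rule no_move1[OF w1]) (use fq[of k] in simp)
    have kl': "Suc k < k + l" using 7 by simp
    show ?thesis
    proof (cases "\<exists>l' d'. d = (k + 2, l') # d'")
      case True
      then obtain l' d' where dd: "d = (k + 2, l') # d'" by blast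
      have l': "1 \<le> l'" and d'': "\<forall>x\<in>set (rsf_word d'). k + 4 \<le> x"
        using d dd rsf_word_ge[of "k + 4" L d'] by (auto simp: add_ac numeral_eq_Suc)
      have s': "rev [k + 2..<k + 2 + l'] = rev [k + 3..<k + 2 + l'] @ [k + 2]"
        using rev_upt_snoc[of "k + 2" "k + 2 + l'"] l' by (simp add: numeral_eq_Suc)
      have "?w1 \<simeq> (?u @ unmarked (rev [k..<k + l])) @ [(k + 1, True)] @ unmarked (rev [k + 3..<k + 2 + l'])
          @ (k + 2, False) # unmarked (rsf_word d')"
        using w1 unfolding dd rsf_word_simps s' by simp
      then have "?w1 \<simeq> (?u @ unmarked (rev [k..<k + l])) @ unmarked (rev [k + 3..<k + 2 + l']) @ [(k + 1, True)]
          @ (k + 2, False) # unmarked (rsf_word d')"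
        by (rule exchange_swap) (auto simp: far_def)
      then have "?w1 \<simeq> (?u @ unmarked (rev [k..<k + l] @ rev [k + 3..<k + 2 + l']))
          @ [(k + 2 - 1, True), (k + 2, False)] @ unmarked (rsf_word d')"
        by simp
      then have m2: "move2 ?w1 ((?u @ unmarked (rev [k..<k + l] @ rev [k + 3..<k + 2 + l']))
          @ [(k + 2, False), (k + 2 - 1, True)] @ unmarked (rsf_word d'))" (is "move2 ?w1 ?w2")
        by (rule move2.intros) (use d'' in \<open>fastforce simp: fresh_below_def\<close>)+
      have w2: "?w2 \<simeq> unmarked (rsf_word e @ rev [k..<k + l] @ rev [k + 2..<k + 2 + l']) @ (k + 1, True)
          # unmarked (rsf_word d')"
        unfolding s' by simp
      have left2: "\<nexists>x. filter (at_bonds k) (rsf_word e @ rev [k..<k + l] @ rev [k + 2..<k + 2 + l']) = x @ [k + 1]"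
        using 7 by (simp add: filter_rev_upt)
      have "filter (at_bonds k) (rsf_word d') = []"
        by (rule filter_at_bonds_ge) (use d'' in fastforce)
      then have nm2: "\<nexists>x. merge ?w2 x"
        by (intro no_merge[OF w2 _ left2, where j = k]) (auto simp: at_bonds_def)
      have "?w2 \<simeq> (?u @ unmarked (rev [Suc k..<k + l])) @ [(k, False)] @ unmarked (rev [k + 2..<k + 2 + l'])
          @ (k + 1, True) # unmarked (rsf_word d')"
        using w2 unfolding kl by simp
      then have "?w2 \<simeq> (?u @ unmarked (rev [Suc k..<k + l])) @ unmarked (rev [k + 2..<k + 2 + l']) @ [(k, False)]
          @ (k + 1, True) # unmarked (rsf_word d')"
        by (rule exchange_swap) (auto simp: far_def)
      then have "?w2 \<simeq> (?u @ unmarked (rev [Suc k..<k + l] @ rev [k + 2..<k + 2 + l']))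
          @ [(k + 1 - 1, False), (k + 1, True)] @ unmarked (rsf_word d')"
        by simp
      then have m3: "move3 ?w2 ((?u @ unmarked (rev [Suc k..<k + l] @ rev [k + 2..<k + 2 + l']))
          @ [(k + 1, True), (k + 1 - 1, False)] @ unmarked (rsf_word d'))" (is "move3 ?w2 ?w3")
        by (rule move3.intros) (use d'' q 7 in \<open>fastforce simp: fresh_below_def\<close>)+
      have "?w3 \<simeq> ?u @ unmarked (rev [k + 1..<k + l]) @ unmarked (rev [k + 1 + 1..<k + 2 + l'])
          @ (k + 1, True) # unmarked (rev [k..<k + 1] @ rev [k + 2..<k + 1 + 1] @ rsf_word d')"
        by (simp add: numeral_eq_Suc)
      from run_step4_loop[OF this] obtain x where x: "run 4 ?w3 x"
        "unmarked (map fst x) \<simeq> unmarked (rsf_word e @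
          (if l \<le> l' + 1 then rev [k..<k + l' + 2] @ rev [k + 2..<k + 1 + l]
           else rev [k..<k + l] @ rev [k + 2..<k + 2 + l']) @ rsf_word d')"
        using 7 l' e by fastforce
      have "k + 1 + l = k + 2 + (l - 1)" using l by simp
      then have "rsf_word (e @ act q ((k, l) # d)) = rsf_word e @
          (if l \<le> l' + 1 then rev [k..<k + l' + 2] @ rev [k + 2..<k + 1 + l]
           else rev [k..<k + l] @ rev [k + 2..<k + 2 + l']) @ rsf_word d'"
        using 7 dd by (simp add: add_ac)
      then show ?thesis
        using run.step1[OF nm m run.skip1[OF nm1 nm11 run.step2[OF nm1 m2 run.step3[OF nm2 m3 x(1)]]]] x(2)
        by metis
    next
      \<comment> \<open>No later sequence touches bond \<open>k + 2\<close>, so step 3 takes the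
        gate past bond \<open>k\<close> to the gate on bond \<open>k + 1\<close>, with which it
        merges.\<close>
      case False
      have d3: "\<forall>x\<in>set (rsf_word d). k + 3 \<le> x"
        using False d rsf_word_ge[of "k + 3" L d] by (cases d) (auto simp: less_eq_Suc_le)
      have "filter (at_bonds (k + 1)) (rsf_word d) = []"
        by (rule filter_at_bonds_ge) (use d3 in fastforce)
      then have nm2: "\<nexists>x. move2 ?w1 x"
        by (intro no_move2[OF w1]) simp
      have "?w1 \<simeq> (?u @ unmarked (rev [Suc k..<k + l])) @ [(k + 1 - 1, False), (k + 1, True)] @ ?v"
        using w1 kl by simp
      then have m3: "move3 ?w1 ((?u @ unmarked (rev [Suc k..<k + l])) @ [(k + 1, True), (k + 1 - 1, False)] @ ?v)"
        (is "move3 ?w1 ?w2")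
        by (rule move3.intros) (use d3 q 7 in \<open>fastforce simp: fresh_below_def\<close>)+
      have "?w2 \<simeq> (?u @ unmarked (rev [Suc (Suc k)..<k + l])) @ [(k + 1, False), (k + 1, True)] @ (k, False) # ?v"
        using rev_upt_snoc[OF kl'] by simp
      from merge.intros(2)[OF this]
      have "run 4 ?w2 ((?u @ unmarked (rev [Suc (Suc k)..<k + l])) @ [(k + 1, False)] @ (k, False) # ?v)"
        (is "run 4 _ ?x")
        by (intro run_merge) auto
      then have "run 1 w ?x"
        by (intro run.step1[OF nm m run.skip1[OF nm1 nm11 run.skip2[OF nm1 nm2 run.step3[OF nm1 m3]]]])
      moreover have "act q ((k, l) # d) = (k, l) # d"
        using 7 False by (auto split: list.splits)
      then have "map fst ?x = rsf_word (e @ act q ((k, l) # d))"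
        using s by simp
      ultimately show ?thesis by (rule run_exI)
    qed
  qed
qed

lemma absorb_eq_act:
  assumes "d \<in> rsf_layouts L" "q \<in> {1..L - 1}"
  shows "absorb L q d = act q d"
proof -
  have d: "layout_from 1 L d" using assms by (simp add: rsf_layouts_eq)
  have "absorbs L q d (act q d)"
    using run_act[OF d, of "[]" q] layout_from_act[OF d, of q] assms(2)
    by (auto simp: absorbs_def rsf_layouts_eq)
  then show ?thesis
    unfolding absorb_def using absorbs_unique by blast
qed

section \<open>The average number of arcs\<close>

fun involutions :: "nat \<Rightarrow> nat" where
  "involutions 0 = 1"
| "involutions (Suc n) = involutions n + n * involutions (n - 1)"

text \<open>Point \<open>c\<close> is fixed or opens an arc to one of the \<open>L - c\<close> later
  points; this is the recursion of \<open>involutions\<close>.\<close>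

lemma layouts_decomp:
  "{d. layout_from c L d} = {d. layout_from (c + 1) L d} \<union>
     (\<lambda>(l, d). (c, l) # d) ` ({1..L - c} \<times> {d. layout_from (c + 2) L d})" (is "?A = ?B \<union> ?C")
proof (intro equalityI subsetI)
  fix d assume "d \<in> ?A"
  then show "d \<in> ?B \<union> ?C"
  proof (cases d)
    case (Cons x d')
    obtain k l where x: "x = (k, l)" by fastforce
    then show ?thesis
      using Cons \<open>d \<in> ?A\<close> by (cases "k = c") (auto simp: image_iff)
  qed simp
next
  fix d assume "d \<in> ?B \<union> ?C"
  then show "d \<in> ?A"
    by (auto elim: layout_from_mono)
qed

lemma layouts_trivial: "L \<le> c \<Longrightarrow> {d. layout_from c L d} = {[]}"
proof (intro equalityI subsetI)
  fix d assume "L \<le> c" "d \<in> {d. layout_from c L d}"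
  then show "d \<in> {[]}" by (cases d) auto
qed auto

lemma finite_layouts: "finite {d. layout_from c L d}"
proof (induction "L - c" arbitrary: c rule: less_induct)
  case less
  show ?case
  proof (cases "L \<le> c")
    case False
    then show ?thesis
      by (subst layouts_decomp) (use less[of "c + 1"] less[of "c + 2"] in auto)
  qed (simp add: layouts_trivial)
qed

lemma sum_layouts:
  fixes f :: "layout \<Rightarrow> nat"
  shows "(\<Sum>d | layout_from c L d. f d) = (\<Sum>d | layout_from (c + 1) L d. f d)
    + (\<Sum>l = 1..L - c. \<Sum>d | layout_from (c + 2) L d. f ((c, l) # d))"
proof -
  have inj: "inj_on (\<lambda>(l, d). (c, l) # d) X" for X :: "(nat \<times> layout) set"
    by (auto simp: inj_on_def)
  have "sum f ((\<lambda>(l, d). (c, l) # d) ` X) = (\<Sum>(l, d)\<in>X. f ((c, l) # d))" for X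
    by (subst sum.reindex[OF inj]) (simp add: comp_def case_prod_beta)
  then show ?thesis
    by (subst layouts_decomp, subst sum.union_disjoint)
      (auto simp: finite_layouts sum.cartesian_product)
qed

lemma card_layouts: "card {d. layout_from c L d} = involutions (L + 1 - c)"
proof (induction "L - c" arbitrary: c rule: less_induct)
  case less
  show ?case
  proof (cases "L \<le> c")
    case True
    then have "L + 1 - c = 0 \<or> L + 1 - c = 1" by linarith
    then show ?thesis using True by (auto simp: layouts_trivial)
  next
    case False
    then have s: "L + 1 - c = Suc (L - c)" by simp
    show ?thesis
      using sum_layouts[of "\<lambda>_. 1" c L] less[of "c + 1"] less[of "c + 2"] False
      unfolding s by simp
  qed
qed

text \<open>The number of arcs that cross bond \<open>m\<close>. Passing below the arc from \<open>k\<close> to \<open>k + l\<close> shifts the labels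
  of the remaining points by one.\<close>

primrec profile :: "layout \<Rightarrow> nat \<Rightarrow> nat" where
  "profile [] m = 0"
| "profile (x # d) m = (if fst x \<le> m \<and> m < fst x + snd x then 1 + profile d (m + 1) else profile d m)"

lemma profile_eq_0: "layout_from c L d \<Longrightarrow> m < c \<Longrightarrow> profile d m = 0"
  by (induction c L d rule: layout_from.induct) auto

text \<open>Each of the \<open>m + 1 - c\<close> points up to \<open>m\<close> is joined to each of
  the \<open>L - m\<close> points after it in \<open>involutions (L - 1 - c)\<close> layouts. The
  proof recurses on the first point, because layouts name points only relative to earlier
  arcs.\<close>

lemma sum_profile:
  "c \<le> m + 1 \<Longrightarrow> m \<le> L \<Longrightarrow>
    (\<Sum>d | layout_from c L d. profile d m) = (m + 1 - c) * (L - m) * involutions (L - 1 - c)"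
proof (induction "L - c" arbitrary: c m rule: less_induct)
  case less
  show ?case
  proof (cases "L \<le> c")
    case True
    then have "(m + 1 - c) * (L - m) = 0" using less.prems by auto
    then show ?thesis using True by (simp add: layouts_trivial)
  next
    case False
    show ?thesis
    proof (cases "m + 1 = c")
      case True
      have "(\<Sum>d | layout_from c L d. profile d m) = 0"
        by (rule sum.neutral) (use True profile_eq_0 in auto)
      then show ?thesis using True by simp
    next
      case m: False
      \<comment> \<open>Besides \<open>c\<close> there are \<open>x\<close> points up to
        \<open>m\<close> and \<open>y\<close> after it; an arc of length \<open>l\<close> from
        \<open>c\<close> crosses \<open>m\<close> iff \<open>l > x\<close>.\<close>
      define x where "x = m - c"
      define y where "y = L - m"
      have mL: "m = c + x" "L = c + x + y" using m less.prems by (auto simp: x_def y_def)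
      have y1: "x + y \<ge> 1" using False mL by linarith
      let ?P = "\<lambda>c m. \<Sum>d | layout_from c L d. profile d m"
      let ?I = involutions
      have P1: "?P (c + 1) m = x * y * ?I (x + y - 2)"
        using less.hyps[of "c + 1" m] False mL by (auto simp: numeral_2_eq_2)
      \<comment> \<open>The factors \<open>y\<close> here and \<open>x\<close> in \<open>P3\<close>
        cover \<open>y = 0\<close> and \<open>x = 0\<close>, where the induction hypothesis does not
        apply.\<close>
      have P2: "y * ?P (c + 2) (m + 1) = y * (x * (y - 1) * ?I (x + y - 3))"
        using less.hyps[of "c + 2" "m + 1"] False mL by (cases "y = 0") (auto simp: numeral_3_eq_3)
      have P3: "x * ?P (c + 2) m = x * ((x - 1) * y * ?I (x + y - 3))"
        using less.hyps[of "c + 2" m] False mL by (cases "x = 0") (auto simp: numeral_3_eq_3)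
      have "(\<Sum>l = 1..L - c. \<Sum>d | layout_from (c + 2) L d. profile ((c, l) # d) m) =
        (\<Sum>l = 1..x + y. if l \<le> x then ?P (c + 2) m else ?I (x + y - 1) + ?P (c + 2) (m + 1))"
      proof (rule sum.cong)
        fix l assume "l \<in> {1..x + y}"
        have "card {d. layout_from (Suc (Suc c)) L d} = ?I (x + y - 1)"
          using mL y1 by (simp add: card_layouts)
        then show "(\<Sum>d | layout_from (c + 2) L d. profile ((c, l) # d) m) =
          (if l \<le> x then ?P (c + 2) m else ?I (x + y - 1) + ?P (c + 2) (m + 1))"
          using mL by (auto simp: sum.distrib sum_Suc)
      qed (use mL in auto)
      also have "\<dots> = x * ?P (c + 2) m + y * (?I (x + y - 1) + ?P (c + 2) (m + 1))"
      proof -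
        have "{1..x + y} \<inter> {l. l \<le> x} = {1..x}" "{1..x + y} \<inter> - {l. l \<le> x} = {x + 1..x + y}"
          by auto
        then show ?thesis by (subst sum.If_cases) auto
      qed
      finally have "?P c m = x * y * ?I (x + y - 2) + x * ((x - 1) * y * ?I (x + y - 3))
        + y * ?I (x + y - 1) + y * (x * (y - 1) * ?I (x + y - 3))"
        unfolding sum_layouts[of _ c] P1 distrib_left P2 P3 by simp
      \<comment> \<open>The recursion combines all terms but the third into
        \<open>x * y * ?I (x + y - 1)\<close>.\<close>
      also have "\<dots> = (x + 1) * y * ?I (x + y - 1)"
      proof (cases "x = 0 \<or> y = 0")
        case False
        then obtain x' y' where xy: "x = Suc x'" "y = Suc y'" by (metis not0_implies_Suc)
        have "?I (x + y - 1) = ?I (x' + y') + (x' + y') * ?I (x' + y' - 1)" using xy by simp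
        moreover have "x + y - 2 = x' + y'" "x + y - 3 = x' + y' - 1" using xy by auto
        ultimately show ?thesis using xy by (simp add: algebra_simps)
      qed auto
      also have "\<dots> = (m + 1 - c) * (L - m) * ?I (L - 1 - c)"
        using mL by (simp add: add.commute)
      finally show ?thesis .
    qed
  qed
qed

section \<open>Growth of the number of involutions\<close>

lemma involutions_pos: "involutions n > 0"
  by (induction n) auto

text \<open>The ratio \<open>r\<close> is followed by \<open>1 + s\<^sup>2 / r\<close> with
  \<open>s\<^sup>2 = n + 1\<close>. This is decreasing in \<open>r\<close>, so each bound produces
  the opposite one for the next ratio.\<close>

lemma involutions_ratio_bounds:
  "sqrt (Suc n) \<le> involutions (Suc n) / involutions n \<and>
   involutions (Suc n) / involutions n \<le> 1 + sqrt (Suc n)"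
proof (induction n)
  case (Suc n)
  define r where "r = real (involutions (Suc n)) / involutions n"
  define s where "s = sqrt (Suc n)"
  have s: "s \<ge> 1" "s\<^sup>2 = real (Suc n)" by (auto simp: s_def)
  have r: "s \<le> r" "r \<le> 1 + s" using Suc by (auto simp: r_def s_def)
  have "real (involutions (Suc (Suc n))) = involutions (Suc n) + Suc n * involutions n"
    by (subst involutions.simps(2)) simp
  also have "\<dots> / involutions (Suc n) = 1 + s\<^sup>2 / r"
    unfolding s r_def using involutions_pos[of n] involutions_pos[of "Suc n"]
    by (simp add: add_divide_distrib algebra_simps del: involutions.simps)
  finally have e: "real (involutions (Suc (Suc n))) / involutions (Suc n) = 1 + s\<^sup>2 / r" .
  have "s\<^sup>2 / r \<le> s"
    using r s(1) mult_left_mono[of s r s] by (simp add: power2_eq_square divide_le_eq)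
  moreover have "s \<le> sqrt (Suc (Suc n))" by (simp add: s_def)
  moreover have "sqrt (Suc (Suc n)) \<le> 1 + s\<^sup>2 / (1 + s)"
  proof (rule real_le_lsqrt)
    have "s\<^sup>2 + 1 \<le> ((s\<^sup>2 + s + 1) / (1 + s))\<^sup>2"
    proof -
      have "(s\<^sup>2 + 1) * (1 + s)\<^sup>2 \<le> (s\<^sup>2 + s + 1)\<^sup>2"
        by (simp add: power2_eq_square algebra_simps)
      then show ?thesis using s(1) by (simp add: power_divide pos_le_divide_eq)
    qed
    also have "(s\<^sup>2 + s + 1) / (1 + s) = 1 + s\<^sup>2 / (1 + s)"
      using s(1) by (simp add: field_simps)
    finally show "real (Suc (Suc n)) \<le> (1 + s\<^sup>2 / (1 + s))\<^sup>2" using s(2) by simp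
  qed (use s in auto)
  moreover have "s\<^sup>2 / (1 + s) \<le> s\<^sup>2 / r"
    using r s by (intro divide_left_mono) auto
  ultimately show ?case unfolding e by linarith
qed simp

text \<open>By the recursion, \<open>(L - 1) * involutions (L - 2) / involutions L\<close> equals
  \<open>1 - involutions (L - 1) / involutions L\<close>, and the last quotient is at most
  \<open>1 / sqrt L\<close>.\<close>

lemma involutions_quotient_tendsto:
  "(\<lambda>L. real L * involutions (L - 2) / involutions L) \<longlonglongrightarrow> 1"
proof -
  have "(\<lambda>n. real (involutions n) / involutions (Suc n)) \<longlonglongrightarrow> 0"
  proof (rule tendsto_sandwich[where f = "\<lambda>_. 0"])
    show "\<forall>\<^sub>F n in sequentially. real (involutions n) / involutions (Suc n) \<le> 1 / sqrt (Suc n)"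
    proof (rule always_eventually, rule allI)
      fix n
      have "1 / (real (involutions (Suc n)) / involutions n) \<le> 1 / sqrt (Suc n)"
        using involutions_ratio_bounds[of n] involutions_pos[of n] involutions_pos[of "Suc n"]
        by (intro divide_left_mono) (auto simp del: involutions.simps)
      then show "real (involutions n) / involutions (Suc n) \<le> 1 / sqrt (Suc n)" by simp
    qed
    show "(\<lambda>n. 1 / sqrt (Suc n)) \<longlonglongrightarrow> 0"
      by (rule LIMSEQ_Suc[where f = "\<lambda>n. 1 / sqrt (real n)"]) 
        (intro tendsto_divide_0[OF tendsto_const] filterlim_at_top_imp_at_infinity
          filterlim_compose[OF sqrt_at_top filterlim_real_sequentially])
  qed (auto intro!: always_eventually)
  then have "(\<lambda>n. (1 + 1 / real (Suc n)) * (1 - real (involutions (Suc n)) / involutions (Suc (Suc n)))) \<longlonglongrightarrow> (1 + 0) * (1 - 0)"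
    by (intro tendsto_intros LIMSEQ_Suc[where f = "\<lambda>n. real (involutions n) / involutions (Suc n)"] LIMSEQ_Suc[OF lim_inverse_n'])
  moreover have "(1 + 1 / real (Suc n)) * (1 - real (involutions (Suc n)) / involutions (Suc (Suc n))) =
     real (Suc (Suc n)) * involutions (Suc (Suc n) - 2) / involutions (Suc (Suc n))" for n
  proof -
    have "real (involutions (Suc (Suc n))) = involutions (Suc n) + Suc n * involutions n"
      by (subst involutions.simps(2)) simp
    then have "1 - real (involutions (Suc n)) / involutions (Suc (Suc n)) =
        Suc n * involutions n / involutions (Suc (Suc n))"
      using involutions_pos[of "Suc (Suc n)"] by (simp add: field_simps del: involutions.simps)
    moreover have "(1 + 1 / real (Suc n)) * Suc n = Suc (Suc n)"
      by (simp add: field_simps)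
    ultimately show ?thesis
      by (simp only: diff_Suc_Suc diff_zero numeral_2_eq_2 of_nat_mult mult.assoc[symmetric] times_divide_eq_right)
  qed
  ultimately have "(\<lambda>n. real (n + 2) * involutions (n + 2 - 2) / involutions (n + 2)) \<longlonglongrightarrow> 1"
    by simp
  then show ?thesis by (rule LIMSEQ_offset)
qed

lemma average_profile_tendsto:
  fixes \<alpha> :: real
  assumes "0 \<le> \<alpha>" "\<alpha> \<le> 1"
  shows "(\<lambda>L. (\<Sum>d | layout_from 1 L d. real (profile d (nat \<lfloor>\<alpha> * L\<rfloor>))) /
      card {d. layout_from 1 L d} / L) \<longlonglongrightarrow> \<alpha> * (1 - \<alpha>)"
proof -
  define m where "m L = nat \<lfloor>\<alpha> * real L\<rfloor>" for L
  have m: "real (m L) \<le> \<alpha> * L" "\<alpha> * L - 1 \<le> real (m L)" for L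
    using assms by (auto simp: m_def)
  have mL: "m L \<le> L" for L
  proof -
    have "\<alpha> * L \<le> L" using assms by (simp add: mult_left_le_one_le)
    then show ?thesis using m(1)[of L] by linarith
  qed
  have "(\<lambda>L. real (m L) / L) \<longlonglongrightarrow> \<alpha>"
  proof (rule tendsto_sandwich)
    show "\<forall>\<^sub>F L in sequentially. \<alpha> - 1 / L \<le> real (m L) / L"
      using eventually_gt_at_top[of 0]
    proof eventually_elim
      case (elim L)
      then show ?case
        using divide_right_mono[OF m(2)[of L], of "real L"] by (simp add: diff_divide_distrib)
    qed
    show "\<forall>\<^sub>F L in sequentially. real (m L) / L \<le> \<alpha>"
      using eventually_gt_at_top[of 0]
      by eventually_elim (use m in \<open>simp add: field_simps\<close>)
    have "(\<lambda>L. \<alpha> - 1 / real L) \<longlonglongrightarrow> \<alpha> - 0"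
      by (intro tendsto_intros lim_1_over_n)
    then show "(\<lambda>L. \<alpha> - 1 / real L) \<longlonglongrightarrow> \<alpha>" by simp
  qed simp
  then have "(\<lambda>L. real (m L) / L * (1 - real (m L) / L) * (real L * involutions (L - 2) / involutions L))
      \<longlonglongrightarrow> \<alpha> * (1 - \<alpha>) * 1"
    by (intro tendsto_intros involutions_quotient_tendsto)
  moreover have "\<forall>\<^sub>F L in sequentially.
      real (m L) / L * (1 - real (m L) / L) * (real L * involutions (L - 2) / involutions L) =
      (\<Sum>d | layout_from 1 L d. real (profile d (m L))) / card {d. layout_from 1 L d} / L"
    using eventually_gt_at_top[of 0]
  proof eventually_elim
    case (elim L)
    have "(\<Sum>d | layout_from 1 L d. real (profile d (m L))) = m L * (L - m L) * involutions (L - 2)"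
      using sum_profile[of 1 "m L" L] mL by (simp flip: of_nat_sum add: numeral_2_eq_2)
    moreover have "real (L - m L) = real L - m L" using mL by simp
    ultimately show ?case
      using elim by (simp add: card_layouts divide_simps)
  qed
  ultimately show ?thesis
    unfolding m_def[symmetric] by (simp add: tendsto_cong)
qed

section \<open>Convergence of symmetric Markov chains\<close>

primrec kernel_power :: "('a \<Rightarrow> 'a pmf) \<Rightarrow> 'a \<Rightarrow> nat \<Rightarrow> 'a pmf" where
  "kernel_power K x 0 = return_pmf x"
| "kernel_power K x (Suc n) = bind_pmf (kernel_power K x n) K"

lemma kernel_power_add:
  "kernel_power K x (m + n) = bind_pmf (kernel_power K x m) (\<lambda>y. kernel_power K y n)"
  by (induction n) (simp_all add: bind_return_pmf' bind_assoc_pmf)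

lemma set_kernel_power:
  assumes "\<And>x. x \<in> X \<Longrightarrow> set_pmf (K x) \<subseteq> X" "x \<in> X"
  shows "set_pmf (kernel_power K x n) \<subseteq> X"
  using assms by (induction n) auto

lemma pmf_bind_finite:
  assumes "finite X" "set_pmf p \<subseteq> X"
  shows "pmf (bind_pmf p f) y = (\<Sum>x\<in>X. pmf p x * pmf (f x) y)"
  unfolding pmf_bind
  by (subst integral_measure_pmf[of X]) (use assms in auto)

lemma pmf_kernel_power_symmetric:
  assumes "finite X" "\<And>x. x \<in> X \<Longrightarrow> set_pmf (K x) \<subseteq> X"
    and "\<And>x y. x \<in> X \<Longrightarrow> y \<in> X \<Longrightarrow> pmf (K x) y = pmf (K y) x"
    and "x \<in> X" "y \<in> X"
  shows "pmf (kernel_power K x n) y = pmf (kernel_power K y n) x"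
  using assms(4,5)
proof (induction n arbitrary: x y)
  case (Suc n)
  have "pmf (kernel_power K x (Suc n)) y = (\<Sum>z\<in>X. pmf (kernel_power K x n) z * pmf (K z) y)"
    using pmf_bind_finite[OF assms(1) set_kernel_power[OF assms(2) Suc.prems(1)]] by simp
  also have "\<dots> = (\<Sum>z\<in>X. pmf (K y) z * pmf (kernel_power K z n) x)"
    by (rule sum.cong) (use Suc assms(3) in auto)
  also have "\<dots> = pmf (bind_pmf (K y) (\<lambda>z. kernel_power K z n)) x"
    by (rule pmf_bind_finite[OF assms(1) assms(2)[OF Suc.prems(2)], symmetric])
  also have "bind_pmf (K y) (\<lambda>z. kernel_power K z n) = kernel_power K y (Suc n)"
    using kernel_power_add[of K y 1 n] by (simp add: bind_return_pmf)
  finally show ?case .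
qed (auto simp: indicator_def)

text \<open>Doeblin's argument: the \<open>N\<close>-step kernel loses at least the common mass \<open>\<epsilon>\<close> at every state,
  which contracts the total variation distance to the uniform distribution.\<close>

lemma symmetric_kernel_tendsto:
  fixes K :: "'a \<Rightarrow> 'a pmf"
  assumes X: "finite X" and K: "\<And>x. x \<in> X \<Longrightarrow> set_pmf (K x) \<subseteq> X"
    and sym: "\<And>x y. x \<in> X \<Longrightarrow> y \<in> X \<Longrightarrow> pmf (K x) y = pmf (K y) x"
    and pos: "\<And>x y. x \<in> X \<Longrightarrow> y \<in> X \<Longrightarrow> pmf (kernel_power K x N) y > 0"
    and x: "x \<in> X"
  shows "(\<lambda>n. pmf (kernel_power K x n) y) \<longlonglongrightarrow> pmf (pmf_of_set X) y"
proof -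
  define u where "u = 1 / real (card X)"
  have cX: "card X > 0" using x X by (auto simp: card_gt_0_iff)
  define V where "V n = (\<Sum>y\<in>X. \<bar>pmf (kernel_power K x n) y - u\<bar>)" for n
  define \<epsilon> where "\<epsilon> = Min ((\<lambda>(x, y). pmf (kernel_power K x N) y) ` (X \<times> X))"
  have ne: "X \<times> X \<noteq> {}" using x by auto
  have eps: "\<epsilon> > 0" unfolding \<epsilon>_def using X ne pos by (subst Min_gr_iff) auto
  have eps_le: "\<epsilon> \<le> pmf (kernel_power K x N) y" if "x \<in> X" "y \<in> X" for x y
    unfolding \<epsilon>_def by (rule Min_le) (use X that in auto)
  have sum1: "(\<Sum>y\<in>X. pmf (kernel_power K z n) y) = 1" if "z \<in> X" for z n
    by (rule sum_pmf_eq_1[OF X set_kernel_power[of X K, OF K that]])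
  have col1: "(\<Sum>z\<in>X. pmf (kernel_power K z n) y) = 1" if "y \<in> X" for y n
  proof -
    have "(\<Sum>z\<in>X. pmf (kernel_power K z n) y) = (\<Sum>z\<in>X. pmf (kernel_power K y n) z)"
      by (rule sum.cong) (use pmf_kernel_power_symmetric[OF X K sym] that in auto)
    then show ?thesis using sum1[OF that] by simp
  qed
  have zero: "(\<Sum>y\<in>X. pmf (kernel_power K x n) y - u) = 0" for n
    using sum1[OF x] cX by (simp add: sum_subtractf u_def)
  have contract: "V (n + m) \<le> (1 - real (card X) * \<delta>) * V n"
    if d: "\<And>z y. z \<in> X \<Longrightarrow> y \<in> X \<Longrightarrow> \<delta> \<le> pmf (kernel_power K z m) y" for n m \<delta>
  proof -
    \<comment> \<open>The columns sum to one, which produces \<open>u\<close>, and the deviations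
      from \<open>u\<close> sum to zero, so subtracting \<open>\<delta>\<close> from the kernel
      changes nothing.\<close>
    have "V (n + m) = (\<Sum>y\<in>X. \<bar>\<Sum>z\<in>X. (pmf (kernel_power K x n) z - u) * (pmf (kernel_power K z m) y - \<delta>)\<bar>)"
      unfolding V_def
    proof (rule sum.cong)
      fix y assume y: "y \<in> X"
      have "(\<Sum>z\<in>X. (pmf (kernel_power K x n) z - u) * (pmf (kernel_power K z m) y - \<delta>)) =
        (\<Sum>z\<in>X. pmf (kernel_power K x n) z * pmf (kernel_power K z m) y) - u * (\<Sum>z\<in>X. pmf (kernel_power K z m) y)
        - (\<Sum>z\<in>X. pmf (kernel_power K x n) z - u) * \<delta>"
        by (simp add: algebra_simps sum_subtractf sum.distrib sum_distrib_left sum_distrib_right)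
      also have "\<dots> = pmf (kernel_power K x (n + m)) y - u"
        unfolding zero col1[OF y] kernel_power_add
        by (subst pmf_bind_finite[OF X set_kernel_power[of X K, OF K x]]) simp_all
      finally show "\<bar>pmf (kernel_power K x (n + m)) y - u\<bar> =
        \<bar>\<Sum>z\<in>X. (pmf (kernel_power K x n) z - u) * (pmf (kernel_power K z m) y - \<delta>)\<bar>" by simp
    qed simp
    also have "\<dots> \<le> (\<Sum>y\<in>X. \<Sum>z\<in>X. \<bar>pmf (kernel_power K x n) z - u\<bar> * (pmf (kernel_power K z m) y - \<delta>))"
      by (intro sum_mono order.trans[OF sum_abs]) (auto simp: abs_mult d intro!: sum_mono)
    also have "\<dots> = (\<Sum>z\<in>X. \<bar>pmf (kernel_power K x n) z - u\<bar> * (\<Sum>y\<in>X. pmf (kernel_power K z m) y - \<delta>))"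
      by (subst sum.swap) (simp add: sum_distrib_left)
    also have "\<dots> = (\<Sum>z\<in>X. \<bar>pmf (kernel_power K x n) z - u\<bar> * (1 - real (card X) * \<delta>))"
      by (rule sum.cong) (use sum1 in \<open>auto simp: sum_subtractf\<close>)
    finally show ?thesis by (simp add: V_def sum_distrib_left mult.commute)
  qed
  define c where "c = 1 - real (card X) * \<epsilon>"
  have c: "c < 1" using eps cX by (simp add: c_def)
  have c0: "0 \<le> c"
  proof -
    have "real (card X) * \<epsilon> = (\<Sum>y\<in>X. \<epsilon>)" by simp
    also have "\<dots> \<le> (\<Sum>y\<in>X. pmf (kernel_power K x N) y)"
      by (rule sum_mono) (use eps_le x in auto)
    finally show ?thesis using sum1[OF x] by (simp add: c_def)
  qed
  \<comment> \<open>The choice \<open>\<delta> = 0\<close> controls the times that are not multiples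
    of \<open>N\<close>.\<close>
  have mono: "V (n + m) \<le> V n" for n m
    using contract[of 0 m n] by simp
  have "V (k * N) \<le> c ^ k * V 0" for k
  proof (induction k)
    case (Suc k)
    have "V (Suc k * N) \<le> c * V (k * N)"
      using contract[of \<epsilon> N "k * N"] eps_le by (simp add: c_def add.commute)
    also have "\<dots> \<le> c * (c ^ k * V 0)" using Suc c0 by (intro mult_left_mono)
    finally show ?case by simp
  qed simp
  have V0: "0 \<le> V n" for n by (simp add: V_def sum_nonneg)
  have "V \<longlonglongrightarrow> 0"
  proof (rule LIMSEQ_I)
    fix e :: real assume e: "0 < e"
    have "(\<lambda>k. c ^ k * V 0) \<longlonglongrightarrow> 0 * V 0"
      by (intro tendsto_intros LIMSEQ_realpow_zero c c0)
    then obtain k where "c ^ k * V 0 < e"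
      using e order_tendstoD(2)[of "\<lambda>k. c ^ k * V 0" 0 sequentially e]
      by (auto simp: eventually_sequentially)
    then have *: "V (k * N) < e" using \<open>V (k * N) \<le> c ^ k * V 0\<close> by simp
    show "\<exists>no. \<forall>n\<ge>no. norm (V n - 0) < e"
    proof (intro exI[of _ "k * N"] allI impI)
      fix n assume "k * N \<le> n"
      then have "V n \<le> V (k * N)" using mono[of "k * N" "n - k * N"] by simp
      then show "norm (V n - 0) < e" using * V0[of n] by simp
    qed
  qed
  show ?thesis
  proof (cases "y \<in> X")
    case True
    have "\<bar>pmf (kernel_power K x n) y - u\<bar> \<le> V n" for n
      unfolding V_def by (rule member_le_sum) (use X True in auto)
    then have "(\<lambda>n. pmf (kernel_power K x n) y - u) \<longlonglongrightarrow> 0"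
      by (intro Lim_null_comparison[OF _ \<open>V \<longlonglongrightarrow> 0\<close>] always_eventually) simp
    moreover have "pmf (pmf_of_set X) y = u"
      using True X x by (subst pmf_of_set) (auto simp: u_def)
    ultimately show ?thesis by (simp add: LIM_zero_iff)
  next
    case False
    have "pmf (kernel_power K x n) y = 0" for n
      using set_kernel_power[of X K, OF K x, of n] False by (auto simp: set_pmf_eq)
    moreover have "pmf (pmf_of_set X) y = 0"
      using False X x by (subst pmf_of_set) auto
    ultimately show ?thesis by simp
  qed
qed

section \<open>Entropy and the stationary distribution\<close>

text \<open>The coefficient matrix is a product with a single nonzero entry, and this entry is a
  nonzero minor.\<close>

lemma schmidt_rank_unit_vec:
  assumes "m \<le> L"
  shows "schmidt_rank L m (unit_vec (2 ^ L) 0) = 1"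
proof -
  define n where "n = (2::nat) ^ m"
  define c where "c = (2::nat) ^ (L - m)"
  have nc: "n > 0" "c > 0" "n * c = 2 ^ L"
    using assms by (auto simp: n_def c_def simp flip: power_add)
  define A where "A = mat n c (\<lambda>(a, b). (unit_vec (2 ^ L) 0 :: complex vec) $ (a * c + b))"
  have A: "A \<in> carrier_mat n c" by (simp add: A_def)
  have entry: "A $$ (a, b) = (if a = 0 then 1 else 0) * (if b = 0 then 1 else 0)" if "a < n" "b < c" for a b
  proof -
    have "a * c + b < Suc a * c" using that by simp
    also have "\<dots> \<le> n * c" using that by (intro mult_le_mono1) simp
    finally have "a * c + b < 2 ^ L" using nc by simp
    then show ?thesis using that nc by (simp add: A_def)
  qed
  have "vec_space.rank n A \<le> 1"
    by (rule vec_space.rank_le_1_product_entries[OF A, of "\<lambda>a. if a = 0 then 1 else 0" "\<lambda>b. if b = 0 then 1 else 0"])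
      (use A in \<open>auto simp only: carrier_matD entry\<close>)
  moreover have "1 \<le> vec_space.rank n A"
  proof -
    have I: "{i. i < n \<and> i \<in> {0}} = {0}" "{j. j < c \<and> j \<in> {0}} = {0}" using nc by auto
    have S: "submatrix A {0} {0} \<in> carrier_mat 1 1"
      by (intro carrier_matI) (simp_all only: dim_submatrix carrier_matD[OF A] I, simp_all)
    have p: "pick {0::nat} 0 = 0" by (auto simp: DL_Missing_Sublist.pick.simps)
    have "submatrix A {0} {0} $$ (0, 0) = A $$ (0, 0)"
      by (subst submatrix_index) (simp_all only: carrier_matD[OF A] I p, simp_all)
    then have "det (submatrix A {0} {0}) \<noteq> 0"
      using det_single[OF S] entry[of 0 0] nc by simp
    from vec_space.rank_gt_minor[OF A this] show ?thesis using I by simp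
  qed
  ultimately show ?thesis
    by (simp add: schmidt_rank_def A_def n_def c_def)
qed

primrec entropy :: "nat list \<Rightarrow> nat \<Rightarrow> nat" where
  "entropy [] m = 0"
| "entropy (j # w) m = (if m = j then 1 + min (entropy w (j - 1)) (entropy w (j + 1)) else entropy w m)"

lemma renyi0_generic:
  assumes "generic L C" "\<forall>j\<in>set (map fst C). 1 \<le> j \<and> j < L" "m \<le> L"
  shows "renyi0 L m (circuit_state L C) = entropy (map fst C) m"
  using assms
proof (induction C arbitrary: m)
  case Nil
  then show ?case by (simp add: renyi0_def circuit_state_def schmidt_rank_unit_vec)
next
  case (Cons x C)
  obtain j G where x: "x = (j, G)" by fastforce
  have "generic L C"
    unfolding generic_def
  proof (intro allI impI)
    fix C2 i H C1 m
    assume "C = C2 @ (i, H) # C1" and m: "m \<le> L"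
    then have "x # C = (x # C2) @ (i, H) # C1" by simp
    from Cons.prems(1)[unfolded generic_def, rule_format, OF this m]
    show "renyi0 L m (circuit_state L ((i, H) # C1)) =
       (if m = i
        then 1 + min (renyi0 L (i - 1) (circuit_state L C1)) (renyi0 L (i + 1) (circuit_state L C1))
        else renyi0 L m (circuit_state L C1))" .
  qed
  then have IH: "renyi0 L m (circuit_state L C) = entropy (map fst C) m" if "m \<le> L" for m
    using Cons.IH Cons.prems(2) that by auto
  have "x # C = [] @ (j, G) # C" by (simp add: x)
  from Cons.prems(1)[unfolded generic_def, rule_format, OF this Cons.prems(3)]
  show ?case using IH Cons.prems by (auto simp: x)
qed

text \<open>Decides the minimum when bond \<open>k + l\<close> extends a sequence: the left
  neighbour, already below the arc, has \<open>1 + profile d (k + l)\<close>, which is at least the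
  value \<open>profile d (k + l + 1)\<close> of the right neighbour.\<close>

lemma profile_Suc_le: "layout_from c L d \<Longrightarrow> profile d (m + 1) \<le> profile d m + 1"
proof (induction c L d arbitrary: m rule: layout_from.induct)
  case (2 c L k l d)
  then have d: "layout_from (k + 2) L d" by simp
  show ?case
    using 2(1)[OF d, of m] 2(1)[OF d, of "m + 1"] profile_eq_0[OF d, of "m + 2"] profile_eq_0[OF d, of m]
    by auto
qed simp

lemma entropy_rsf_word: "layout_from c L d \<Longrightarrow> 1 \<le> c \<Longrightarrow> entropy (rsf_word d) = profile d"
proof (induction c L d rule: layout_from.induct)
  case (2 c L k l d)
  have d: "layout_from (k + 2) L d" and k: "1 \<le> k" using 2 by auto
  have IH: "entropy (rsf_word d) = profile d" using 2 by simp
  have "entropy (rev [k..<k + l] @ rsf_word d) m =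
      (if k \<le> m \<and> m < k + l then 1 + profile d (m + 1) else profile d m)" for m
  proof (induction l arbitrary: m)
    case 0
    then show ?case by (simp add: IH)
  next
    case (Suc l)
    show ?case
    proof (cases "l = 0")
      case True
      then show ?thesis
        using Suc[of "k - 1"] Suc[of "k + 1"] Suc[of m] k profile_eq_0[OF d, of "k - 1"]
          profile_eq_0[OF d, of "k + 1"] by auto
    next
      case False
      then show ?thesis
        using Suc[of "k + l - 1"] Suc[of "k + l + 1"] Suc[of m] k profile_Suc_le[OF d, of "k + l"]
        by auto
    qed
  qed
  then show ?case by auto
qed auto

lemma renyi0_rsf_circuit:
  assumes "d \<in> rsf_layouts L" "rsf_circuit d C" "generic L C" "m \<le> L"
  shows "renyi0 L m (circuit_state L C) = profile d m"
proof -
  have d: "layout_from 1 L d" using assms(1) by (simp add: rsf_layouts_eq)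
  have w: "map fst C = rsf_word d" using assms(2) by (simp add: rsf_circuit_def)
  have "\<forall>j\<in>set (rsf_word d). 1 \<le> j \<and> j < L"
    using assms(1) by (fastforce simp: rsf_layouts_def rsf_word_def)
  then show ?thesis
    using renyi0_generic[OF assms(3) _ assms(4)] entropy_rsf_word[OF d] by (simp add: w)
qed

section \<open>The disentangler as the inverse of absorption\<close>

lemma removable_iff:
  assumes "b \<in> {1..L - 1}"
  shows "removable L b d d' \<longleftrightarrow> d' \<in> rsf_layouts L \<and> act b d' = d \<and> d' \<noteq> d"
  using assms length_act[of 1 L d' b] absorb_eq_act[of d' L b]
  by (auto simp: removable_def rsf_layouts_eq)

lemma disentangle_removable:
  assumes "b \<in> {1..L - 1}" "removable L b d d'"
  shows "disentangle L b d = d'"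
proof -
  have "x = deact b d" if "removable L b d x" for x
    using that deact_act[of 1 L x b] by (auto simp: removable_iff[OF assms(1)] rsf_layouts_eq)
  then have ex1: "\<exists>!d'. removable L b d d'" using assms(2) by blast
  show ?thesis
    using assms(2) the1_equality[OF ex1 assms(2)] by (auto simp: disentangle_def)
qed

lemma disentangle_eq_iff:
  assumes "b \<in> {1..L - 1}" "d \<in> rsf_layouts L" "d' \<in> rsf_layouts L" "d \<noteq> d'"
  shows "disentangle L b d = d' \<longleftrightarrow> absorb L b d' = d"
proof
  assume *: "disentangle L b d = d'"
  then obtain x where x: "removable L b d x"
    using assms(4) by (auto simp: disentangle_def split: if_splits)
  then show "absorb L b d' = d"
    using disentangle_removable[OF assms(1) x] * by (simp add: removable_def)
next
  assume "absorb L b d' = d"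
  then have "removable L b d d'"
    using assms by (simp add: removable_iff[OF assms(1)] absorb_eq_act)
  then show "disentangle L b d = d'" by (rule disentangle_removable[OF assms(1)])
qed

lemma absorb_in_layouts:
  assumes "d \<in> rsf_layouts L" "b \<in> {1..L - 1}"
  shows "absorb L b d \<in> rsf_layouts L"
  using assms layout_from_act[of 1 L d b] by (simp add: absorb_eq_act) (auto simp: rsf_layouts_eq)

lemma disentangle_in_layouts:
  assumes "d \<in> rsf_layouts L" "b \<in> {1..L - 1}"
  shows "disentangle L b d \<in> rsf_layouts L"
proof (cases "\<exists>d'. removable L b d d'")
  case True
  then show ?thesis using disentangle_removable[OF assms(2)] by (auto simp: removable_def)
qed (simp add: disentangle_def assms)

lemma pmf_game_step:
  assumes "2 \<le> L"
  shows "pmf (game_step L (1 / 2) d) d' =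
    (\<Sum>b = 1..L - 1. (of_bool (disentangle L b d = d') + of_bool (absorb L b d = d')) / 2) / real (L - 1)"
  using assms unfolding game_step_def
  by (subst pmf_bind_pmf_of_set) (auto simp: pmf_bind indicator_def of_bool_def add_divide_distrib sum.distrib)

lemma set_game_step:
  assumes "2 \<le> L" "d \<in> rsf_layouts L"
  shows "set_pmf (game_step L p d) \<subseteq> rsf_layouts L"
  using assms absorb_in_layouts disentangle_in_layouts
  by (auto simp: game_step_def set_pmf_of_set split: if_splits)

text \<open>At \<open>p = 1/2\<close> a bond is as likely to add a gate as it is to remove that gate again.\<close>

lemma game_step_symmetric:
  assumes "2 \<le> L" "d \<in> rsf_layouts L" "d' \<in> rsf_layouts L"
  shows "pmf (game_step L (1 / 2) d) d' = pmf (game_step L (1 / 2) d') d"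
proof (cases "d = d'")
  case False
  then show ?thesis
    using assms disentangle_eq_iff[of _ L d d'] disentangle_eq_iff[of _ L d' d]
    by (auto simp: pmf_game_step intro!: sum.cong)
qed simp

lemma finite_rsf_layouts: "finite (rsf_layouts L)"
  unfolding rsf_layouts_eq by (rule finite_layouts)

lemma Nil_in_layouts: "[] \<in> rsf_layouts L"
  by (simp add: rsf_layouts_eq)

section \<open>Irreducibility, aperiodicity and the uniform limit\<close>

lemma kernel_power_reach:
  assumes "2 \<le> L" "set w \<subseteq> {1..L - 1}"
  shows "foldr act w [] \<in> rsf_layouts L \<and>
    foldr act w [] \<in> set_pmf (kernel_power (game_step L (1 / 2)) [] (length w))"
  using assms(2)
proof (induction w)
  case (Cons q w)
  let ?d = "foldr act w []"
  have d: "?d \<in> rsf_layouts L" "?d \<in> set_pmf (kernel_power (game_step L (1 / 2)) [] (length w))"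
    using Cons by auto
  have q: "q \<in> {1..L - 1}" using Cons.prems by simp
  have "act q ?d \<in> rsf_layouts L"
    using absorb_in_layouts[OF d(1) q] absorb_eq_act[OF d(1) q] by simp
  moreover have "act q ?d \<in> set_pmf (game_step L (1 / 2) ?d)"
    using q assms(1) absorb_eq_act[OF d(1) q]
    by (auto simp: game_step_def set_pmf_of_set intro!: bexI[of _ q] exI[of _ False])
  ultimately show ?case using d(2) by auto
qed (simp add: Nil_in_layouts)

lemma game_positive:
  assumes "2 \<le> L"
  shows "\<exists>N. \<forall>d\<in>rsf_layouts L. \<forall>d'\<in>rsf_layouts L. pmf (kernel_power (game_step L (1 / 2)) d N) d' > 0"
proof -
  let ?K = "game_step L (1 / 2)" and ?X = "rsf_layouts L"
  \<comment> \<open>Any common bound on the numbers of gates would do; idle steps at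
    \<open>[]\<close> fill the remaining time.\<close>
  define N where "N = (\<Sum>d\<in>?X. length (rsf_word d))"
  \<comment> \<open>No layout has fewer gates than \<open>[]\<close>, so the disentangler idles
    there; this loop excludes periodicity.\<close>
  have "\<not> removable L 1 [] d'" for d' by (simp add: removable_def)
  then have "disentangle L 1 [] = []" by (auto simp: disentangle_def)
  then have loop: "[] \<in> set_pmf (?K [])"
    using assms by (auto simp: game_step_def set_pmf_of_set intro!: bexI[of _ 1] exI[of _ True])
  have stay: "[] \<in> set_pmf (kernel_power ?K [] n)" for n
    by (induction n) (use loop in auto)
  have reach: "d \<in> set_pmf (kernel_power ?K [] N)" if d: "d \<in> ?X" for d
  proof -
    have le: "length (rsf_word d) \<le> N"
      unfolding N_def by (rule member_le_sum) (use d finite_rsf_layouts in auto)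
    have "set (rsf_word d) \<subseteq> {1..L - 1}"
      using d by (fastforce simp: rsf_layouts_def rsf_word_def)
    then have "d \<in> set_pmf (kernel_power ?K [] (length (rsf_word d)))"
      using kernel_power_reach[OF assms, of "rsf_word d"] foldr_act_rsf_word[of 1 L d] d
      by (simp add: rsf_layouts_eq)
    then have "d \<in> set_pmf (kernel_power ?K [] ((N - length (rsf_word d)) + length (rsf_word d)))"
      unfolding kernel_power_add using stay by auto
    then show ?thesis using le by simp
  qed
  \<comment> \<open>A symmetric kernel lets every path be reversed.\<close>
  have returns: "[] \<in> set_pmf (kernel_power ?K d N)" if d: "d \<in> ?X" for d
    using reach[OF d] pmf_kernel_power_symmetric[OF finite_rsf_layouts set_game_step[OF assms]
        game_step_symmetric[OF assms] d Nil_in_layouts, of N]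
    by (simp add: set_pmf_iff)
  have "d' \<in> set_pmf (kernel_power ?K d (N + N))" if "d \<in> ?X" "d' \<in> ?X" for d d'
    unfolding kernel_power_add using returns[OF that(1)] reach[OF that(2)] by auto
  then show ?thesis by (auto simp: pmf_positive_iff intro!: exI[of _ "N + N"])
qed

lemma evolve_eq_kernel_power: "evolve L p d n = kernel_power (game_step L p) d n"
  by (induction n) simp_all

lemma stationary_uniform:
  assumes "2 \<le> L"
  shows "stationary L (1 / 2) = pmf_of_set (rsf_layouts L)"
proof -
  let ?K = "game_step L (1 / 2)" and ?X = "rsf_layouts L"
  have ne: "?X \<noteq> {}" using Nil_in_layouts by auto
  obtain N where N: "\<And>d d'. d \<in> ?X \<Longrightarrow> d' \<in> ?X \<Longrightarrow> pmf (kernel_power ?K d N) d' > 0"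
    using game_positive[OF assms] by blast
  have lim: "(\<lambda>n. pmf (evolve L (1 / 2) d0 n) d) \<longlonglongrightarrow> pmf (pmf_of_set ?X) d" if "d0 \<in> ?X" for d0 d
    unfolding evolve_eq_kernel_power
    by (rule symmetric_kernel_tendsto[OF finite_rsf_layouts set_game_step[OF assms]
          game_step_symmetric[OF assms] N that])
  have "bind_pmf (pmf_of_set ?X) ?K = pmf_of_set ?X"
  proof (rule pmf_eqI)
    fix d
    \<comment> \<open>By symmetry the columns of the kernel sum to one as its rows do, which is
      invariance of the uniform distribution.\<close>
    have "(\<Sum>x\<in>?X. pmf (?K x) d) = indicator ?X d"
    proof (cases "d \<in> ?X")
      case True
      have "(\<Sum>x\<in>?X. pmf (?K x) d) = (\<Sum>x\<in>?X. pmf (?K d) x)"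
        by (rule sum.cong) (use game_step_symmetric[OF assms] True in auto)
      also have "\<dots> = 1"
        by (rule sum_pmf_eq_1[OF finite_rsf_layouts set_game_step[OF assms True]])
      finally show ?thesis using True by simp
    next
      case False
      then have "pmf (?K x) d = 0" if "x \<in> ?X" for x
        using set_game_step[OF assms that] by (auto simp: set_pmf_eq)
      then show ?thesis using False by simp
    qed
    then show "pmf (bind_pmf (pmf_of_set ?X) ?K) d = pmf (pmf_of_set ?X) d"
      by (simp add: pmf_bind_pmf_of_set[OF ne finite_rsf_layouts] pmf_of_set[OF ne finite_rsf_layouts])
  qed
  then have "is_stationary L (1 / 2) (pmf_of_set ?X)"
    using lim by (simp add: is_stationary_def set_pmf_of_set[OF ne finite_rsf_layouts])
  moreover have "\<pi> = pmf_of_set ?X" if "is_stationary L (1 / 2) \<pi>" for \<pi>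
  proof (rule pmf_eqI)
    fix d
    have "(\<lambda>n. pmf (evolve L (1 / 2) [] n) d) \<longlonglongrightarrow> pmf \<pi> d"
      using that Nil_in_layouts by (auto simp: is_stationary_def)
    then show "pmf \<pi> d = pmf (pmf_of_set ?X) d"
      using lim[OF Nil_in_layouts] by (rule LIMSEQ_unique)
  qed
  ultimately show ?thesis unfolding stationary_def by (rule the_equality)
qed

theorem corollary2:
  fixes \<alpha> :: real and circ :: "nat \<Rightarrow> layout \<Rightarrow> circuit"
  assumes "0 \<le> \<alpha>" and "\<alpha> \<le> 1"
    and "\<And>L d. d \<in> rsf_layouts L \<Longrightarrow> rsf_circuit d (circ L d)"
    and "\<And>L d. d \<in> rsf_layouts L \<Longrightarrow> generic L (circ L d)"
  shows "(\<lambda>L. mean_renyi0 L (1 / 2) (circ L) (nat \<lfloor>\<alpha> * real L\<rfloor>) / real L)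
           \<longlonglongrightarrow> \<alpha> * (1 - \<alpha>)"
proof -
  have "\<forall>\<^sub>F L in sequentially.
    (\<Sum>d | layout_from 1 L d. real (profile d (nat \<lfloor>\<alpha> * L\<rfloor>))) / card {d. layout_from 1 L d} / L =
    mean_renyi0 L (1 / 2) (circ L) (nat \<lfloor>\<alpha> * real L\<rfloor>) / real L"
    \<comment> \<open>For \<open>L < 2\<close> there is no bond to choose, so the stationary
      distribution is identified from \<open>L = 2\<close> on.\<close>
    using eventually_ge_at_top[of 2]
  proof eventually_elim
    case (elim L)
    have "\<alpha> * L \<le> L" using assms by (simp add: mult_left_le_one_le)
    then have m: "nat \<lfloor>\<alpha> * real L\<rfloor> \<le> L" by linarith
    have "mean_renyi0 L (1 / 2) (circ L) (nat \<lfloor>\<alpha> * real L\<rfloor>) =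
      (\<Sum>d\<in>rsf_layouts L. renyi0 L (nat \<lfloor>\<alpha> * real L\<rfloor>) (circuit_state L (circ L d))) / card (rsf_layouts L)"
      unfolding mean_renyi0_def stationary_uniform[OF elim]
      using Nil_in_layouts finite_rsf_layouts by (subst integral_pmf_of_set) auto
    also have "\<dots> = (\<Sum>d\<in>rsf_layouts L. real (profile d (nat \<lfloor>\<alpha> * L\<rfloor>))) / card (rsf_layouts L)"
      using renyi0_rsf_circuit assms m by simp
    finally show ?case by (simp add: rsf_layouts_eq)
  qed
  with average_profile_tendsto[OF assms(1,2)] show ?thesis
    by (rule Lim_transform_eventually)
qed

end
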